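(* Let $\mathbb{F}$ be an algebraically closed field of characteristic zero and let $\mathcal{A}$ be a two-dimensional $\mathbb{F}$-algebra with a non-trivial automorphism group $\mathrm{Aut}(\mathcal{A})$. (a) The algebra $\mathcal{A}$ has a symmetric invariant nondegenerate bilinear form if and only if $\mathcal{A}$ is isomorphic to one of the following algebras: - $\mathbf{A}_4(0)$; - $\mathbf{C}(\alpha,0)$ for $\alpha\in\mathbb{F}$; - $\mathbf{D}_1(\alpha,2\alpha-1)$ for $(\alpha,2\alpha-1)\in\mathcal{U}$; - $\mathbf{E}_1(\alpha,\beta,\beta,\alpha)$ for $(\alpha,\beta,\beta,\alpha)\in\mathcal{V}$, $(\alpha,\beta)\neq(-1,-1)$; - $\mathbf{E}_1(-1,-1,-1,-1)$; - $\mathbf{E}_3(\alpha,\alpha,-1)$ for $\alpha\in\mathbb{F}$. (b) The algebra $\mathcal{A}$ has a skew-symmetric invariant nondegenerate bilinear form if and only if $\mathcal{A}$ is isomorphic to one of the following algebras: - $\mathbf{A}_1(\alpha)$ for $\alpha\in\mathbb{F}$; - $\mathbf{A}_2$.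
   Context: An algebra is a vector space with a bilinear multiplication, not necessarily associative. A bilinear form $\varphi:\mathcal{A}^2\to\mathbb{F}$ is invariant if $\varphi(g\cdot a,g\cdot b)=\varphi(a,b)$ for all $g\in\mathrm{Aut}(\mathcal{A})$ (the group of algebra automorphisms) and $a,b\in\mathcal{A}$; symmetric if $\varphi(a,b)=\varphi(b,a)$; skew-symmetric if $\varphi(a,b)=-\varphi(b,a)$ for all $a,b\in\mathcal{A}$. Each algebra below has basis $e_1,e_2$ and is given by the products $(e_1e_1,\;e_1e_2,\;e_2e_1,\;e_2e_2)$: $\mathbf{A}_1(\alpha)$: $(e_1+e_2,\;\alpha e_2,\;(1-\alpha)e_2,\;0)$; $\mathbf{A}_2$: $(e_2,\;e_2,\;-e_2,\;0)$; $\mathbf{A}_4(0)$: $(e_2,\;e_1,\;-e_1,\;0)$; $\mathbf{C}(\alpha,0)$: $(e_2,\;(1-\alpha)e_1,\;\alpha e_1,\;e_2)$; $\mathbf{D}_1(\alpha,\beta)$: $(e_1,\;(1-\alpha)e_1+\beta e_2,\;\alpha e_1-\beta e_2,\;0)$; $\mathbf{E}_1(\alpha,\beta,\gamma,\delta)$: $(e_1,\;\alpha e_1+\beta e_2,\;\gamma e_1+\delta e_2,\;e_2)$; $\mathbf{E}_3(\alpha,\alpha,-1)$: $(e_1,\;(\alpha-1)e_1-\alpha e_2,\;-\alpha e_1+(\alpha-1)e_2,\;e_2)$. Parameter sets (arbitrary but fixed choices of orbit representatives): $\mathcal{U}$ is a set of representatives of the orbits of $\mathbb{F}^2$ under the involution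 $(\alpha,\beta)\mapsto(1-\alpha+\beta,\beta)$. Let $\mathcal{T}=\{(\alpha,\beta)\in\mathbb{F}^2:\alpha+\beta=1\}$. For $\Gamma=(\alpha,\beta,\gamma,\delta)\in\mathbb{F}^4$ put $D(\Gamma)=(\alpha+\gamma)(\beta+\delta)-1$, $C_1(\Gamma)=(\beta,\delta)$, $C_2(\Gamma)=(\gamma,\alpha)$ and, if $D(\Gamma)\ne0$, $C_3(\Gamma)=\left(\frac{\beta\gamma-(\alpha-1)(\delta-1)}{D(\Gamma)},\frac{\alpha\delta-(\beta-1)(\gamma-1)}{D(\Gamma)}\right)$. The symmetric group $\mathcal{S}_3$ acts by permuting the components on the set of triples $(C_1(\Gamma),C_2(\Gamma),C_3(\Gamma))$ with $\Gamma\in\mathbb{F}^4$, $D(\Gamma)\neq0$, $C_1(\Gamma),C_2(\Gamma)\notin\mathcal{T}$. Fix a set $\widetilde{\mathcal{V}}$ of representatives of the orbits of this action such that for every $(C_1,C_2,C_3)\in\widetilde{\mathcal{V}}$ with $C_1\neq C_2$ one has $C_3\neq C_1$ and $C_3\neq C_2$. Then $\mathcal{V}$ is the set of all $\Gamma\in\mathbb{F}^4$ with $D(\Gamma)\neq0$, $C_1(\Gamma),C_2(\Gamma)\notin\mathcal{T}$ and $(C_1(\Gamma),C_2(\Gamma),C_3(\Gamma))\in\widetilde{\mathcal{V}}$. *)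

theory Defs
  imports "HOL-Analysis.Analysis"
begin

section \<open>Algebras, automorphisms and invariant forms\<close>

definition bilinear_map ::
  "('f::field \<Rightarrow> 'a::ab_group_add \<Rightarrow> 'a) \<Rightarrow> ('f \<Rightarrow> 'b::ab_group_add \<Rightarrow> 'b) \<Rightarrow> ('a \<Rightarrow> 'a \<Rightarrow> 'b) \<Rightarrow> bool"
  where "bilinear_map s t f \<longleftrightarrow>
    (\<forall>x. Vector_Spaces.linear s t (f x)) \<and> (\<forall>y. Vector_Spaces.linear s t (\<lambda>x. f x y))"

text \<open>The multiplication is not assumed to be associative, commutative or unital.\<close>

locale algebra_over = vector_space scale
  for scale :: "'f::field \<Rightarrow> 'a::ab_group_add \<Rightarrow> 'a" +
  fixes mult :: "'a \<Rightarrow> 'a \<Rightarrow> 'a"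
  assumes bilinear_mult: "bilinear_map scale scale mult"

definition algebra_iso ::
  "('f::field \<Rightarrow> 'a::ab_group_add \<Rightarrow> 'a) \<Rightarrow> ('a \<Rightarrow> 'a \<Rightarrow> 'a) \<Rightarrow>
   ('f \<Rightarrow> 'b::ab_group_add \<Rightarrow> 'b) \<Rightarrow> ('b \<Rightarrow> 'b \<Rightarrow> 'b) \<Rightarrow> ('a \<Rightarrow> 'b) set"
  where "algebra_iso s m t n =
    {g. Vector_Spaces.linear s t g \<and> bij g \<and> (\<forall>x y. g (m x y) = n (g x) (g y))}"

definition algebra_aut ::
  "('f::field \<Rightarrow> 'a::ab_group_add \<Rightarrow> 'a) \<Rightarrow> ('a \<Rightarrow> 'a \<Rightarrow> 'a) \<Rightarrow> ('a \<Rightarrow> 'a) set"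
  where "algebra_aut s m = algebra_iso s m s m"

definition algebra_isomorphic ::
  "('f::field \<Rightarrow> 'a::ab_group_add \<Rightarrow> 'a) \<Rightarrow> ('a \<Rightarrow> 'a \<Rightarrow> 'a) \<Rightarrow>
   ('f \<Rightarrow> 'b::ab_group_add \<Rightarrow> 'b) \<Rightarrow> ('b \<Rightarrow> 'b \<Rightarrow> 'b) \<Rightarrow> bool"
  where "algebra_isomorphic s m t n \<longleftrightarrow> algebra_iso s m t n \<noteq> {}"

definition bilinear_form ::
  "('f::field \<Rightarrow> 'a::ab_group_add \<Rightarrow> 'a) \<Rightarrow> ('a \<Rightarrow> 'a \<Rightarrow> 'f) \<Rightarrow> bool"
  where "bilinear_form s \<phi> \<longleftrightarrow> bilinear_map s (*) \<phi>"

definition invariant_form ::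
  "('f::field \<Rightarrow> 'a::ab_group_add \<Rightarrow> 'a) \<Rightarrow> ('a \<Rightarrow> 'a \<Rightarrow> 'a) \<Rightarrow> ('a \<Rightarrow> 'a \<Rightarrow> 'f) \<Rightarrow> bool"
  where "invariant_form s m \<phi> \<longleftrightarrow> (\<forall>g\<in>algebra_aut s m. \<forall>a b. \<phi> (g a) (g b) = \<phi> a b)"

definition symmetric_form :: "('a \<Rightarrow> 'a \<Rightarrow> 'f) \<Rightarrow> bool"
  where "symmetric_form \<phi> \<longleftrightarrow> (\<forall>a b. \<phi> a b = \<phi> b a)"

definition skew_symmetric_form :: "('a \<Rightarrow> 'a \<Rightarrow> 'f::field) \<Rightarrow> bool"
  where "skew_symmetric_form \<phi> \<longleftrightarrow> (\<forall>a b. \<phi> a b = - \<phi> b a)"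

definition nondegenerate_form :: "('a::ab_group_add \<Rightarrow> 'a \<Rightarrow> 'f::field) \<Rightarrow> bool"
  where "nondegenerate_form \<phi> \<longleftrightarrow>
    (\<forall>a. (\<forall>b. \<phi> a b = 0) \<longrightarrow> a = 0) \<and> (\<forall>b. (\<forall>a. \<phi> a b = 0) \<longrightarrow> b = 0)"

section \<open>The two-dimensional algebras, realised on \<open>'f ^ 2\<close>\<close>

abbreviation e1 :: "'f::field ^ 2" where "e1 \<equiv> axis 1 1"
abbreviation e2 :: "'f::field ^ 2" where "e2 \<equiv> axis 2 1"

text \<open>\<open>table_mult p q r s\<close> is the bilinear multiplication with
  \<open>e1 e1 = p\<close>, \<open>e1 e2 = q\<close>, \<open>e2 e1 = r\<close>, \<open>e2 e2 = s\<close>.\<close>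

definition table_mult ::
  "'f::field ^ 2 \<Rightarrow> 'f ^ 2 \<Rightarrow> 'f ^ 2 \<Rightarrow> 'f ^ 2 \<Rightarrow> 'f ^ 2 \<Rightarrow> 'f ^ 2 \<Rightarrow> 'f ^ 2"
  where "table_mult p q r s x y =
    (x $ 1 * y $ 1) *s p + (x $ 1 * y $ 2) *s q + (x $ 2 * y $ 1) *s r + (x $ 2 * y $ 2) *s s"

definition alg_A1 :: "'f::field \<Rightarrow> 'f ^ 2 \<Rightarrow> 'f ^ 2 \<Rightarrow> 'f ^ 2"
  where "alg_A1 \<alpha> = table_mult (e1 + e2) (\<alpha> *s e2) ((1 - \<alpha>) *s e2) 0"

definition alg_A2 :: "'f::field ^ 2 \<Rightarrow> 'f ^ 2 \<Rightarrow> 'f ^ 2"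
  where "alg_A2 = table_mult e2 e2 (- e2) 0"

text \<open>\<open>alg_A4_0\<close>, \<open>alg_C_0 \<alpha>\<close> and \<open>alg_E3_diag \<alpha>\<close> are the members \<open>\<^bold>A\<^sub>4(0)\<close>,
  \<open>\<^bold>C(\<alpha>, 0)\<close> and \<open>\<^bold>E\<^sub>3(\<alpha>, \<alpha>, -1)\<close> of families with more parameters.\<close>

definition alg_A4_0 :: "'f::field ^ 2 \<Rightarrow> 'f ^ 2 \<Rightarrow> 'f ^ 2"
  where "alg_A4_0 = table_mult e2 e1 (- e1) 0"

definition alg_C_0 :: "'f::field \<Rightarrow> 'f ^ 2 \<Rightarrow> 'f ^ 2 \<Rightarrow> 'f ^ 2"
  where "alg_C_0 \<alpha> = table_mult e2 ((1 - \<alpha>) *s e1) (\<alpha> *s e1) e2"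

definition alg_D1 :: "'f::field \<Rightarrow> 'f \<Rightarrow> 'f ^ 2 \<Rightarrow> 'f ^ 2 \<Rightarrow> 'f ^ 2"
  where "alg_D1 \<alpha> \<beta> =
    table_mult e1 ((1 - \<alpha>) *s e1 + \<beta> *s e2) (\<alpha> *s e1 - \<beta> *s e2) 0"

definition alg_E1 :: "'f::field \<Rightarrow> 'f \<Rightarrow> 'f \<Rightarrow> 'f \<Rightarrow> 'f ^ 2 \<Rightarrow> 'f ^ 2 \<Rightarrow> 'f ^ 2"
  where "alg_E1 \<alpha> \<beta> \<gamma> \<delta> =
    table_mult e1 (\<alpha> *s e1 + \<beta> *s e2) (\<gamma> *s e1 + \<delta> *s e2) e2"

definition alg_E3_diag :: "'f::field \<Rightarrow> 'f ^ 2 \<Rightarrow> 'f ^ 2 \<Rightarrow> 'f ^ 2"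
  where "alg_E3_diag \<alpha> =
    table_mult e1 ((\<alpha> - 1) *s e1 - \<alpha> *s e2) (- \<alpha> *s e1 + (\<alpha> - 1) *s e2) e2"

section \<open>The parameter sets\<close>

text \<open>\<open>G\<close> is a group of transformations of \<open>X\<close>, given as a set of functions; \<open>R\<close> contains
  exactly one element of every orbit.\<close>

definition orbit_representatives :: "('x \<Rightarrow> 'x) set \<Rightarrow> 'x set \<Rightarrow> 'x set \<Rightarrow> bool"
  where "orbit_representatives G X R \<longleftrightarrow>
    R \<subseteq> X \<and> (\<forall>x\<in>X. \<exists>!r. r \<in> R \<and> r \<in> (\<lambda>g. g x) ` G)"

definition U_involution :: "'f::field \<times> 'f \<Rightarrow> 'f \<times> 'f"
  where "U_involution = (\<lambda>(\<alpha>, \<beta>). (1 - \<alpha> + \<beta>, \<beta>))"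

definition is_U :: "('f::field \<times> 'f) set \<Rightarrow> bool"
  where "is_U \<U> \<longleftrightarrow> orbit_representatives {id, U_involution} UNIV \<U>"

definition param_T :: "('f::field \<times> 'f) set"
  where "param_T = {(\<alpha>, \<beta>). \<alpha> + \<beta> = 1}"

definition param_D :: "'f::field \<times> 'f \<times> 'f \<times> 'f \<Rightarrow> 'f"
  where "param_D = (\<lambda>(\<alpha>, \<beta>, \<gamma>, \<delta>). (\<alpha> + \<gamma>) * (\<beta> + \<delta>) - 1)"

definition param_C1 :: "'f::field \<times> 'f \<times> 'f \<times> 'f \<Rightarrow> 'f \<times> 'f"
  where "param_C1 = (\<lambda>(\<alpha>, \<beta>, \<gamma>, \<delta>). (\<beta>, \<delta>))"

definition param_C2 :: "'f::field \<times> 'f \<times> 'f \<times> 'f \<Rightarrow> 'f \<times> 'f"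
  where "param_C2 = (\<lambda>(\<alpha>, \<beta>, \<gamma>, \<delta>). (\<gamma>, \<alpha>))"

text \<open>Only meaningful, and only used, where \<open>param_D\<close> does not vanish.\<close>

definition param_C3 :: "'f::field \<times> 'f \<times> 'f \<times> 'f \<Rightarrow> 'f \<times> 'f"
  where "param_C3 = (\<lambda>(\<alpha>, \<beta>, \<gamma>, \<delta>).
    ((\<beta> * \<gamma> - (\<alpha> - 1) * (\<delta> - 1)) / param_D (\<alpha>, \<beta>, \<gamma>, \<delta>),
     (\<alpha> * \<delta> - (\<beta> - 1) * (\<gamma> - 1)) / param_D (\<alpha>, \<beta>, \<gamma>, \<delta>)))"

definition param_triple :: "'f::field \<times> 'f \<times> 'f \<times> 'f \<Rightarrow> ('f \<times> 'f) ^ 3"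
  where "param_triple \<Gamma> = vector [param_C1 \<Gamma>, param_C2 \<Gamma>, param_C3 \<Gamma>]"

definition admissible :: "('f::field \<times> 'f \<times> 'f \<times> 'f) set"
  where "admissible = {\<Gamma>. param_D \<Gamma> \<noteq> 0 \<and> param_C1 \<Gamma> \<notin> param_T \<and> param_C2 \<Gamma> \<notin> param_T}"

definition S3_action :: "('x ^ 3 \<Rightarrow> 'x ^ 3) set"
  where "S3_action = {(\<lambda>t. \<chi> i. t $ inv \<pi> i) | \<pi> :: 3 \<Rightarrow> 3. bij \<pi>}"

definition is_V_tilde :: "(('f::field \<times> 'f) ^ 3) set \<Rightarrow> bool"
  where "is_V_tilde W \<longleftrightarrow>
    orbit_representatives S3_action (param_triple ` admissible) W \<and>
    (\<forall>t\<in>W. t $ 1 \<noteq> t $ 2 \<longrightarrow> t $ 3 \<noteq> t $ 1 \<and> t $ 3 \<noteq> t $ 2)"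

definition V_of :: "(('f::field \<times> 'f) ^ 3) set \<Rightarrow> ('f \<times> 'f \<times> 'f \<times> 'f) set"
  where "V_of W = {\<Gamma> \<in> admissible. param_triple \<Gamma> \<in> W}"

end

theory Submission
  imports Defs
begin

text \<open>
Everything is read off from one nontrivial automorphism \<open>g\<close> and its eigenvectors. Since the
field is algebraically closed, \<open>g\<close> is either diagonal in a suitable basis \<open>(u, v)\<close>, with eigenvalues
\<open>t, w\<close>, or a Jordan block (lemma \<open>eigenframe\<close>). Applying \<open>g\<close> to the products of basis vectors
annihilates most structure constants, and applying it to \<open>\<phi> u u\<close>, \<open>\<phi> u v\<close>, \<open>\<phi> v v\<close> annihilates most
entries of the Gram matrix of an invariant form \<open>\<phi>\<close>.

The symmetric case is the case of \<open>\<int>/2\<close>-graded algebras: those with a basis for which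
\<open>uu = a v\<close>, \<open>uv = b u\<close>, \<open>vu = c u\<close>, \<open>vv = d v\<close>. If \<open>\<phi>\<close> is symmetric, a Jordan block cannot preserve it,
so \<open>g\<close> is diagonal, and either its eigenvalues are \<open>\<plusminus>1\<close>, which yields a grading directly
(\<open>graded_if_involution\<close>), or they are \<open>t, 1/t\<close> with \<open>t\<^sup>2 \<noteq> 1\<close>, where the only possible products
\<open>uu = p v\<close>, \<open>vv = s u\<close> have a hidden symmetry exchanging \<open>u\<close> and \<open>v\<close> up to scalars
(\<open>graded_if_torus\<close>). Moreover \<open>a \<noteq> 0\<close> and \<open>(b, c, d) \<noteq> 0\<close>, since otherwise there are automorphisms
stretching the basis vectors too freely (\<open>graded_frame_nontrivial\<close>). Conversely, when \<open>a = 1\<close> and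
\<open>(b, c, d) \<noteq> 0\<close>, every automorphism is \<open>u \<mapsto> \<plusminus>u, v \<mapsto> v\<close>, except when \<open>b = c = - d\<close>, where the group
also contains elements of order three; the form \<open>diag(1, b)\<close> is preserved even then
(\<open>orthogonal_if_aut_equations\<close>). It remains to recognise the graded algebras in the list: rescaling
the basis normalises \<open>a\<close> and the overall size of \<open>(b, c, d)\<close>, and the listed families are distinguished by
which of \<open>d\<close>, \<open>b + c\<close>, \<open>b + c - d\<close> vanish (\<open>graded_imp_listed\<close>).

In the skew-symmetric case invariance of \<open>\<phi>\<close> says that all automorphisms have determinant \<open>1\<close>. A graded
algebra has the reflection \<open>u \<mapsto> - u, v \<mapsto> v\<close>, so it is excluded, and by the same two lemmas \<open>g\<close> is not
diagonal. It is therefore a unipotent Jordan block, and commuting with it forces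
\<open>uu = (q + r) u + p v\<close>, \<open>uv = q v\<close>, \<open>vu = r v\<close>, \<open>vv = 0\<close> (\<open>skew_form_imp_triangular\<close>); excluding gradings
once more leaves, after rescaling, the algebras \<open>\<^bold>A\<^sub>1(\<alpha>)\<close> and \<open>\<^bold>A\<^sub>2\<close>.

The parameters found in this way belong to \<open>\<U>\<close> and \<open>\<V>\<close> for every choice of representatives:
\<open>(\<alpha>, 2\<alpha> - 1)\<close> is a fixed point of the involution, and a triple with \<open>C\<^sub>1 = C\<^sub>2\<close> is the only element
of its orbit that the side condition on the representatives admits (\<open>diagonal_in_U\<close>, \<open>symmetric_in_V\<close>).
\<close>

section \<open>Frames of a two-dimensional algebra\<close>

context algebra_over
begin

definition comb :: "'a \<Rightarrow> 'a \<Rightarrow> 'f \<Rightarrow> 'f \<Rightarrow> 'a"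
  where "comb u v a b = scale a u + scale b v"

definition frame :: "'a \<Rightarrow> 'a \<Rightarrow> bool"
  where "frame u v \<longleftrightarrow> (\<forall>a b. comb u v a b = 0 \<longrightarrow> a = 0 \<and> b = 0) \<and> (\<forall>x. \<exists>a b. x = comb u v a b)"

lemma comb_add: "comb u v a b + comb u v c d = comb u v (a + c) (b + d)"
  and comb_diff: "comb u v a b - comb u v c d = comb u v (a - c) (b - d)"
  and comb_scale: "scale k (comb u v a b) = comb u v (k * a) (k * b)"
  and comb_fst: "u = comb u v 1 0"
  and comb_snd: "v = comb u v 0 1"
  and comb_zero: "0 = comb u v 0 0"
  by (simp_all add: comb_def algebra_simps)

lemma comb_comb:
  "comb (comb u v x y) (comb u v z w) a b = comb u v (a * x + b * z) (a * y + b * w)"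
  by (simp add: comb_def algebra_simps)

lemma linear_comb:
  assumes "Vector_Spaces.linear scale t g"
  shows "g (comb u v a b) = t a (g u) + t b (g v)"
  using assms by (simp add: comb_def Vector_Spaces.linear_iff)

lemma mult_comb:
  "mult (comb u v a b) (comb u' v' c d) =
    scale (a * c) (mult u u') + scale (a * d) (mult u v') + scale (b * c) (mult v u') + scale (b * d) (mult v v')"
  using bilinear_mult by (simp add: comb_def bilinear_map_def Vector_Spaces.linear_iff algebra_simps)

lemma frame_eq_iff:
  assumes "frame u v"
  shows "comb u v a b = comb u v c d \<longleftrightarrow> a = c \<and> b = d"
proof -
  have "comb u v a b = comb u v c d \<longleftrightarrow> comb u v (a - c) (b - d) = 0"
    using comb_diff[of u v a b c d] by auto
  also have "\<dots> \<longleftrightarrow> a - c = 0 \<and> b - d = 0"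
    using assms comb_zero[of u v] by (metis frame_def)
  finally show ?thesis by simp
qed

lemma frame_zero_iff:
  assumes "frame u v"
  shows "comb u v a b = 0 \<longleftrightarrow> a = 0 \<and> b = 0"
  using frame_eq_iff[OF assms, of a b 0 0] comb_zero[of u v] by simp

lemma frameE:
  assumes "frame u v"
  obtains a b where "x = comb u v a b"
  using assms unfolding frame_def by metis

text \<open>Cramer's rule: the columns of the adjugate matrix give linear relations if the determinant
vanishes, and coordinates with respect to the new pair if it does not.\<close>

lemma frame_comb_iff:
  assumes "frame u v"
  shows "frame (comb u v x y) (comb u v z w) \<longleftrightarrow> x * w - y * z \<noteq> 0"
proof
  assume f: "frame (comb u v x y) (comb u v z w)"
  show "x * w - y * z \<noteq> 0"
  proof
    assume d: "x * w - y * z = 0"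
    have "comb (comb u v x y) (comb u v z w) w (- y) = 0"
      "comb (comb u v x y) (comb u v z w) (- z) x = 0"
      using d by (simp_all add: comb_comb frame_zero_iff[OF assms] algebra_simps)
    then have "w = 0 \<and> y = 0" "z = 0 \<and> x = 0"
      unfolding frame_zero_iff[OF f] by simp_all
    moreover have "comb u v x y \<noteq> 0"
      using frame_zero_iff[OF f, of 1 0] by (simp add: comb_fst[symmetric])
    ultimately show False by (simp add: comb_def)
  qed
next
  assume d: "x * w - y * z \<noteq> 0"
  show "frame (comb u v x y) (comb u v z w)"
    unfolding frame_def
  proof (intro conjI allI impI)
    fix a b
    assume "comb (comb u v x y) (comb u v z w) a b = 0"
    then have "a * x + b * z = 0" "a * y + b * w = 0"
      by (simp_all add: comb_comb frame_zero_iff[OF assms])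
    then have "a * (x * w - y * z) = 0" "b * (x * w - y * z) = 0"
      by algebra+
    then show "a = 0" "b = 0" using d by auto
  next
    fix t
    obtain a b where t: "t = comb u v a b" using assms by (rule frameE)
    obtain i where i: "i * (x * w - y * z) = 1" using d left_inverse by blast
    have "t = comb (comb u v x y) (comb u v z w) (i * (a * w - b * z)) (i * (b * x - a * y))"
      unfolding t comb_comb frame_eq_iff[OF assms] using i by (intro conjI) algebra+
    then show "\<exists>a b. t = comb (comb u v x y) (comb u v z w) a b" by blast
  qed
qed

lemma frame_swap: "frame u v \<Longrightarrow> frame v u"
  using frame_comb_iff[of u v 0 1 1 0] by (simp add: comb_def)

lemma frame_coordinates:
  assumes "frame u v"
  obtains h :: "'a \<Rightarrow> 'f ^ 2" where "Vector_Spaces.linear scale (*s) h" "bij h"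
    "\<And>a b. h (comb u v a b) = a *s e1 + b *s e2"
proof -
  define k where "k = (\<lambda>y::'f^2. comb u v (y $ 1) (y $ 2))"
  have inj: "inj k"
    by (rule injI) (simp add: k_def frame_eq_iff[OF assms] vec_eq_iff forall_2)
  have inv: "inv k (comb u v a b) = a *s e1 + b *s e2" for a b
    using inv_f_f[OF inj, of "a *s e1 + b *s e2"] by (simp add: k_def axis_def)
  have "surj k"
  proof (rule surjI)
    fix x show "k (inv k x) = x"
      using assms by (rule frameE[of _ _ x]) (simp add: inv, simp add: k_def axis_def)
  qed
  with inj have "bij (inv k)" by (intro bij_imp_bij_inv bijI)
  moreover have "Vector_Spaces.linear scale (*s) (inv k)"
    unfolding Vector_Spaces.linear_iff
  proof (intro conjI allI)
    show "vector_space scale" "vector_space ((*s) :: 'f \<Rightarrow> 'f^2 \<Rightarrow> _)" by unfold_locales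
    fix x y and c :: 'f
    obtain a b a' b' where "x = comb u v a b" "y = comb u v a' b'" using assms by (metis frameE)
    then show "inv k (x + y) = inv k x + inv k y" "inv k (scale c x) = c *s inv k x"
      by (simp_all add: comb_add comb_scale inv vec_eq_iff forall_2 axis_def)
  qed
  ultimately show thesis using inv that by blast
qed

lemma frame_image:
  assumes "frame u v" "Vector_Spaces.linear scale scale g" "bij g"
  shows "frame (g u) (g v)"
proof -
  have c: "comb (g u) (g v) a b = g (comb u v a b)" for a b
    using assms(2) by (simp add: linear_comb) (simp add: comb_def)
  have "g 0 = 0" using c[of 0 0] by (simp add: comb_def)
  show ?thesis
    unfolding frame_def
  proof (intro conjI allI impI)
    fix a b assume "comb (g u) (g v) a b = 0"
    then have "g (comb u v a b) = g 0" using \<open>g 0 = 0\<close> by (simp add: c)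
    then have "comb u v a b = 0" using assms(3) by (simp add: bij_def inj_eq)
    then show "a = 0" "b = 0" by (simp_all add: frame_zero_iff[OF assms(1)])
  next
    fix x
    obtain y where "x = g y" using assms(3) by (meson bij_pointE)
    moreover obtain a b where "y = comb u v a b" using assms(1) by (rule frameE)
    ultimately show "\<exists>a b. x = comb (g u) (g v) a b" using c by metis
  qed
qed

lemma frame_exists:
  assumes "dim (UNIV :: 'a set) = 2"
  obtains u v where "frame u v"
proof -
  obtain B where "independent B" "UNIV \<subseteq> span B" "card B = 2"
    using basis_exists[of UNIV] assms by metis
  then have B: "independent B" "span B = UNIV" "card B = 2" by auto
  then obtain u v where uv: "B = {u, v}" "u \<noteq> v" by (meson card_2_iff)
  have "frame u v"
    unfolding frame_def
  proof (intro conjI allI impI)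
    fix a b assume z: "comb u v a b = 0"
    have sum: "(\<Sum>x\<in>B. scale (if x = u then a else b) x) = 0"
      using uv z by (auto simp: comb_def)
    then have "(if x = u then a else b) = 0" if "x \<in> B" for x
      using independentD[OF B(1) _ order_refl sum that] uv by simp
    from this[of u] this[of v] show "a = 0" "b = 0" using uv by auto
  next
    fix x
    have "x \<in> span {u, v}" using B uv by simp
    then obtain a b where "x - scale a u = scale b v"
      by (auto simp: span_insert span_singleton)
    then have "x = comb u v a b" by (simp add: comb_def diff_eq_eq add.commute)
    then show "\<exists>a b. x = comb u v a b" by blast
  qed
  then show thesis by (rule that)
qed

text \<open>An isomorphism onto a coordinate algebra amounts to a frame with the prescribed products, namely
the preimages of the standard basis. This moves every question about the listed algebras into the given
algebra, where only changes of frame remain.\<close>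

lemma isomorphic_table_iff:
  "algebra_isomorphic scale mult (*s) (table_mult p q r s) \<longleftrightarrow>
    (\<exists>u v. frame u v \<and> mult u u = comb u v (p $ 1) (p $ 2) \<and> mult u v = comb u v (q $ 1) (q $ 2)
       \<and> mult v u = comb u v (r $ 1) (r $ 2) \<and> mult v v = comb u v (s $ 1) (s $ 2))"
  (is "?L \<longleftrightarrow> ?R")
proof
  assume ?L
  then obtain h where lin: "Vector_Spaces.linear scale (*s) h" and bij: "bij h"
    and hom: "\<And>x y. h (mult x y) = table_mult p q r s (h x) (h y)"
    by (auto simp: algebra_isomorphic_def algebra_iso_def)
  define u v where "u = inv h e1" and "v = inv h e2"
  have h: "h u = e1" "h v = e2"
    using bij by (simp_all add: u_def v_def bij_def surj_f_inv_f)
  have hc: "h (comb u v a b) = a *s e1 + b *s e2" for a b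
    by (simp add: linear_comb[OF lin] h)
  have inj: "h x = h y \<longleftrightarrow> x = y" for x y using bij by (simp add: bij_def inj_eq)
  have prod: "mult x y = comb u v (c $ 1) (c $ 2)" if "table_mult p q r s (h x) (h y) = c" for x y c
    using that by (simp add: inj[symmetric] hom hc vec_eq_iff forall_2 axis_def)
  have "frame u v"
    unfolding frame_def
  proof (intro conjI allI impI)
    fix a b assume "comb u v a b = 0"
    then have "h (comb u v a b) = h (comb u v 0 0)" by (simp add: comb_zero[symmetric])
    then have "a *s e1 + b *s e2 = (0 :: 'f^2)" unfolding hc by simp
    then show "a = 0" "b = 0" by (simp_all add: vec_eq_iff forall_2 axis_def)
  next
    fix x
    have "x = comb u v (h x $ 1) (h x $ 2)"
      by (simp add: inj[symmetric] hc vec_eq_iff forall_2 axis_def)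
    then show "\<exists>a b. x = comb u v a b" by blast
  qed
  moreover have "mult u u = comb u v (p $ 1) (p $ 2)" "mult u v = comb u v (q $ 1) (q $ 2)"
    "mult v u = comb u v (r $ 1) (r $ 2)" "mult v v = comb u v (s $ 1) (s $ 2)"
    by (rule prod, simp add: h table_mult_def axis_def)+
  ultimately show ?R by blast
next
  assume ?R
  then obtain u v where fr: "frame u v" and t: "mult u u = comb u v (p $ 1) (p $ 2)"
    "mult u v = comb u v (q $ 1) (q $ 2)" "mult v u = comb u v (r $ 1) (r $ 2)"
    "mult v v = comb u v (s $ 1) (s $ 2)" by blast
  obtain h :: "'a \<Rightarrow> 'f ^ 2" where h: "Vector_Spaces.linear scale (*s) h" "bij h"
    "\<And>a b. h (comb u v a b) = a *s e1 + b *s e2" using fr by (rule frame_coordinates) blast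
  have "h (mult x y) = table_mult p q r s (h x) (h y)" for x y
  proof -
    obtain a b c d where "x = comb u v a b" "y = comb u v c d" using fr by (metis frameE)
    then show ?thesis
      by (simp add: mult_comb t comb_add comb_scale h(3) table_mult_def vec_eq_iff forall_2 axis_def)
  qed
  then have "h \<in> algebra_iso scale mult (*s) (table_mult p q r s)"
    using h by (simp add: algebra_iso_def)
  then show ?L by (auto simp: algebra_isomorphic_def)
qed

lemmas isomorphic_tableI = isomorphic_table_iff[THEN iffD2, OF exI, OF exI, OF conjI, OF _ conjI, OF _ _ conjI, OF _ _ _ conjI]

text \<open>Two frames with the same structure constants differ by an automorphism, because the linear map
between them respects the products of basis vectors. All automorphisms constructed below arise so.\<close>

lemma aut_of_frames:
  assumes "frame u v" "frame u' v'"
    and "mult u u = comb u v p1 p2" "mult u v = comb u v q1 q2"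
    and "mult v u = comb u v r1 r2" "mult v v = comb u v s1 s2"
    and "mult u' u' = comb u' v' p1 p2" "mult u' v' = comb u' v' q1 q2"
    and "mult v' u' = comb u' v' r1 r2" "mult v' v' = comb u' v' s1 s2"
  obtains g where "g \<in> algebra_aut scale mult" "g u = u'" "g v = v'"
proof -
  obtain h :: "'a \<Rightarrow> 'f ^ 2" where h: "Vector_Spaces.linear scale (*s) h" "bij h"
    "\<And>a b. h (comb u v a b) = a *s e1 + b *s e2" using assms(1) by (rule frame_coordinates) blast
  define g where "g = (\<lambda>x. comb u' v' (h x $ 1) (h x $ 2))"
  have g: "g (comb u v a b) = comb u' v' a b" for a b
    by (simp add: g_def h axis_def)
  have "Vector_Spaces.linear scale scale g"
    using h(1) by (simp add: Vector_Spaces.linear_iff g_def comb_add comb_scale)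
  moreover have "bij g"
  proof (rule bijI)
    show "inj g"
    proof (rule injI)
      fix x y assume e: "g x = g y"
      obtain a b c d where "x = comb u v a b" "y = comb u v c d" using assms(1) by (metis frameE)
      with e show "x = y" by (simp add: g frame_eq_iff[OF assms(2)])
    qed
    show "surj g" unfolding surj_def using g assms(2) by (metis frameE)
  qed
  moreover have "g (mult x y) = mult (g x) (g y)" for x y
  proof -
    obtain a b c d where "x = comb u v a b" "y = comb u v c d" using assms(1) by (metis frameE)
    then show ?thesis by (simp add: g mult_comb assms(3-) comb_add comb_scale)
  qed
  ultimately have "g \<in> algebra_aut scale mult" by (simp add: algebra_aut_def algebra_iso_def)
  moreover have "g u = u'" "g v = v'"
    using g[of 1 0] g[of 0 1] by (simp_all add: comb_def)
  ultimately show thesis by (rule that)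
qed


section \<open>Invariant forms in a frame\<close>

lemma autE:
  assumes "g \<in> algebra_aut scale mult" "frame u v"
  obtains x y z w where "g u = comb u v x y" "g v = comb u v z w" "x * w - y * z \<noteq> 0"
    "\<And>a b. g (comb u v a b) = comb u v (a * x + b * z) (a * y + b * w)"
    "\<And>t t'. g (mult t t') = mult (g t) (g t')"
proof -
  have g: "Vector_Spaces.linear scale scale g" "bij g" "\<And>t t'. g (mult t t') = mult (g t) (g t')"
    using assms(1) by (auto simp: algebra_aut_def algebra_iso_def)
  obtain x y z w where xy: "g u = comb u v x y" "g v = comb u v z w" using assms(2) by (metis frameE)
  moreover have "x * w - y * z \<noteq> 0"
    using frame_image[OF assms(2) g(1,2)] by (simp add: xy frame_comb_iff[OF assms(2)])
  moreover have "g (comb u v a b) = comb u v (a * x + b * z) (a * y + b * w)" for a b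
    by (simp add: linear_comb[OF g(1)] xy comb_scale comb_add)
  ultimately show thesis using g(3) that by blast
qed

lemma aut_comb:
  assumes "g \<in> algebra_aut scale mult"
  shows "g (comb u v a b) = comb (g u) (g v) a b"
  using assms
  by (simp add: algebra_aut_def algebra_iso_def comb_def Vector_Spaces.linear_iff)

lemma aut_mult: "g \<in> algebra_aut scale mult \<Longrightarrow> g (mult x y) = mult (g x) (g y)"
  by (simp add: algebra_aut_def algebra_iso_def)

lemma not_id_on_frame:
  assumes "frame u v" "g \<in> algebra_aut scale mult" "g \<noteq> id"
  shows "g u \<noteq> u \<or> g v \<noteq> v"
proof (rule ccontr)
  assume e: "\<not> ?thesis"
  have "g x = x" for x
  proof -
    obtain a b where "x = comb u v a b" using assms(1) by (rule frameE)
    then show ?thesis using e by (simp add: aut_comb[OF assms(2)])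
  qed
  then show False using assms(3) by (simp add: fun_eq_iff)
qed

lemma nontrivial_aut_obtain:
  assumes "algebra_aut scale mult \<noteq> {id}"
  obtains g where "g \<in> algebra_aut scale mult" "g \<noteq> id"
proof -
  have "id \<in> algebra_aut scale mult"
    using vector_space_axioms by (simp add: algebra_aut_def algebra_iso_def Vector_Spaces.linear_iff)
  then show thesis using assms that by blast
qed

lemma form_comb:
  assumes "bilinear_form scale \<phi>"
  shows "\<phi> (comb u v a b) (comb u v c d) =
    a * c * \<phi> u u + a * d * \<phi> u v + b * c * \<phi> v u + b * d * \<phi> v v"
  using assms
  by (simp add: comb_def bilinear_form_def bilinear_map_def Vector_Spaces.linear_iff algebra_simps)

lemma nondegenerate_row:
  assumes "frame u v" "bilinear_form scale \<phi>" "nondegenerate_form \<phi>"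
  shows "\<phi> u u \<noteq> 0 \<or> \<phi> u v \<noteq> 0"
proof (rule ccontr)
  assume z: "\<not> ?thesis"
  have "\<phi> u x = 0" for x
  proof -
    obtain a b where "x = comb u v a b" using assms(1) by (rule frameE)
    then show ?thesis using form_comb[OF assms(2), of u v 1 0 a b] z by (simp add: comb_fst[symmetric])
  qed
  then have "u = 0" using assms(3) by (simp add: nondegenerate_form_def)
  then show False using frame_zero_iff[OF assms(1), of 1 0] by (simp add: comb_fst[symmetric])
qed

lemma form_exists:
  assumes "frame u v"
  obtains \<phi> where "bilinear_form scale \<phi>" 
    "\<And>a b c d. \<phi> (comb u v a b) (comb u v c d) = a * c * A + a * d * B + b * c * C + b * d * D"
proof -
  obtain h :: "'a \<Rightarrow> 'f ^ 2" where h: "Vector_Spaces.linear scale (*s) h"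
    "\<And>a b. h (comb u v a b) = a *s e1 + b *s e2" using assms(1) by (rule frame_coordinates) blast
  define \<phi> where "\<phi> = (\<lambda>x y. h x $ 1 * h y $ 1 * A + h x $ 1 * h y $ 2 * B + h x $ 2 * h y $ 1 * C
    + h x $ 2 * h y $ 2 * D)"
  have "vector_space ((*) :: 'f \<Rightarrow> 'f \<Rightarrow> 'f)" by unfold_locales
  then have "bilinear_form scale \<phi>"
    using h(1) by (simp add: bilinear_form_def bilinear_map_def Vector_Spaces.linear_iff \<phi>_def algebra_simps)
  then show thesis by (rule that) (simp add: \<phi>_def h axis_def)
qed

lemma nondegenerate_if_det:
  assumes "frame u v" and d: "A * D - B * C \<noteq> 0"
    and \<phi>: "\<And>a b c d. \<phi> (comb u v a b) (comb u v c d) = a * c * A + a * d * B + b * c * C + b * d * D"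
  shows "nondegenerate_form \<phi>"
  unfolding nondegenerate_form_def
proof (intro conjI allI impI)
  fix x assume z: "\<forall>y. \<phi> x y = 0"
  obtain a b where x: "x = comb u v a b" using assms(1) by (rule frameE)
  have "a * A + b * C = 0" "a * B + b * D = 0"
    using z[rule_format, of "comb u v 1 0"] z[rule_format, of "comb u v 0 1"] by (simp_all add: x \<phi>)
  then have "a * (A * D - B * C) = 0" "b * (A * D - B * C) = 0" by algebra+
  then show "x = 0" using d by (simp add: x comb_def)
next
  fix y assume z: "\<forall>x. \<phi> x y = 0"
  obtain a b where y: "y = comb u v a b" using assms(1) by (rule frameE)
  have "a * A + b * B = 0" "a * C + b * D = 0"
    using z[rule_format, of "comb u v 1 0"] z[rule_format, of "comb u v 0 1"] by (simp_all add: y \<phi>)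
  then have "a * (A * D - B * C) = 0" "b * (A * D - B * C) = 0" by algebra+
  then show "y = 0" using d by (simp add: y comb_def)
qed

lemma invariant_if_on_frame:
  assumes "frame u v" "bilinear_form scale \<phi>"
    and "\<And>g. g \<in> algebra_aut scale mult \<Longrightarrow>
      \<phi> (g u) (g u) = \<phi> u u \<and> \<phi> (g u) (g v) = \<phi> u v \<and> \<phi> (g v) (g u) = \<phi> v u \<and> \<phi> (g v) (g v) = \<phi> v v"
  shows "invariant_form scale mult \<phi>"
  unfolding invariant_form_def
proof (intro ballI allI)
  fix g x y assume g: "g \<in> algebra_aut scale mult"
  obtain a b c d where "x = comb u v a b" "y = comb u v c d" using assms(1) by (metis frameE)
  then show "\<phi> (g x) (g y) = \<phi> x y"
    using assms(3)[OF g] by (simp add: aut_comb[OF g] form_comb[OF assms(2)])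
qed

section \<open>Graded frames\<close>

text \<open>Frames adapted to a \<open>\<int>/2\<close>-grading with \<open>u\<close> odd and \<open>v\<close> even: these products are the ones
for which \<open>u \<mapsto> - u\<close>, \<open>v \<mapsto> v\<close> is an automorphism.\<close>

definition graded_frame :: "'a \<Rightarrow> 'a \<Rightarrow> 'f \<Rightarrow> 'f \<Rightarrow> 'f \<Rightarrow> 'f \<Rightarrow> bool"
  where "graded_frame u v a b c d \<longleftrightarrow> frame u v \<and> mult u u = comb u v 0 a \<and> mult u v = comb u v b 0
    \<and> mult v u = comb u v c 0 \<and> mult v v = comb u v 0 d"

text \<open>The new constant \<open>a'\<close> is given by an equation, not as \<open>k\<^sup>2 a / m\<close>, because later its value is
prescribed and \<open>k\<close> is a square root found accordingly.\<close>

lemma graded_frame_rescale: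
  assumes "graded_frame u v a b c d" "k \<noteq> 0" "m \<noteq> 0" "m * a' = k ^ 2 * a"
  shows "graded_frame (comb u v k 0) (comb u v 0 m) a' (m * b) (m * c) (m * d)"
  using assms
  by (simp add: graded_frame_def frame_comb_iff mult_comb comb_add comb_scale comb_comb frame_eq_iff power2_eq_square algebra_simps)

lemma graded_diagonal_aut:
  assumes "graded_frame u v a b c d" "x \<noteq> 0" "y \<noteq> 0"
    and "x ^ 2 * a = y * a" "y * b = b" "y * c = c" "y * d = d"
  obtains g where "g \<in> algebra_aut scale mult" "g u = comb u v x 0" "g v = comb u v 0 y"
proof -
  have fr: "frame u v" using assms(1) by (simp add: graded_frame_def)
  have gr: "graded_frame (comb u v x 0) (comb u v 0 y) a b c d"
    using graded_frame_rescale[OF assms(1-3), of a] assms(4-) by simp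
  show thesis
    using aut_of_frames[OF fr, of "comb u v x 0" "comb u v 0 y" 0 a b 0 c 0 0 d] assms(1) gr that
    unfolding graded_frame_def by blast
qed

end

lemma alg_closed_quadratic_root:
  fixes a b c :: "'f::alg_closed_field"
  assumes "a \<noteq> 0"
  obtains x where "a * x ^ 2 + b * x + c = 0"
proof -
  obtain x where "(\<Sum>k\<le>2. (if k = 0 then c else if k = 1 then b else a) * x ^ k) = 0"
    using alg_closed[of 2 "\<lambda>k. if k = 0 then c else if k = 1 then b else a"] assms by auto
  then show thesis
    by (intro that[of x]) (simp add: numeral_2_eq_2 algebra_simps)
qed

lemma eq_neg_self_imp_zero:
  fixes a :: "'f::field_char_0"
  assumes "a = - a"
  shows "a = 0"
proof -
  have "2 * a = 0" using assms by (metis add.right_inverse mult_2)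
  then show ?thesis by simp
qed

locale planar_algebra = algebra_over scale mult
  for scale :: "'f::{alg_closed_field, field_char_0} \<Rightarrow> 'a::ab_group_add \<Rightarrow> 'a" and mult +
  assumes dim_two: "dim (UNIV :: 'a set) = 2"
begin

text \<open>If \<open>a = 0\<close> then doubling \<open>u\<close> and fixing \<open>v\<close> is an automorphism; if \<open>b = c = d = 0\<close> then
\<open>u \<mapsto> 2u\<close>, \<open>v \<mapsto> 4v\<close> is one. Either way \<open>u\<close> is orthogonal to \<open>u\<close> and to \<open>v\<close>, so the form is degenerate.\<close>

lemma graded_frame_nontrivial:
  assumes gr: "graded_frame u v a b c d"
    and \<phi>: "bilinear_form scale \<phi>" "invariant_form scale mult \<phi>" "nondegenerate_form \<phi>"
  shows "a \<noteq> 0" "\<not> (b = 0 \<and> c = 0 \<and> d = 0)"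
proof -
  have fr: "frame u v" using gr by (simp add: graded_frame_def)
  \<comment> \<open>The automorphism \<open>u \<mapsto> 2u\<close>, \<open>v \<mapsto> y v\<close> multiplies \<open>\<phi> u u\<close> by \<open>4\<close> and \<open>\<phi> u v\<close> by \<open>2y\<close>.\<close>
  have no: False if y: "y \<noteq> 0" "2 * y \<noteq> 1" "2 ^ 2 * a = y * a" "y * b = b" "y * c = c" "y * d = d" for y
  proof -
    obtain g where g: "g \<in> algebra_aut scale mult" "g u = comb u v 2 0" "g v = comb u v 0 y"
      by (rule graded_diagonal_aut[OF gr _ y(1) y(3-6)]) simp
    have "\<phi> (g u) (g u) = \<phi> u u" "\<phi> (g u) (g v) = \<phi> u v"
      using \<phi>(2) g(1) by (auto simp: invariant_form_def)
    then have "4 * \<phi> u u = \<phi> u u" "(2 * y - 1) * \<phi> u v = 0"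
      by (simp_all add: g form_comb[OF \<phi>(1)] algebra_simps)
    then have "\<phi> u u = 0" "\<phi> u v = 0" using y(2) by auto
    then show False using nondegenerate_row[OF fr \<phi>(1,3)] by simp
  qed
  show "a \<noteq> 0" using no[of 1] by auto
  show "\<not> (b = 0 \<and> c = 0 \<and> d = 0)" using no[of 4] by auto
qed

text \<open>A product of eigenvectors is an eigenvector for the product of the eigenvalues. With eigenvalues
\<open>\<plusminus>1\<close> this is the grading rule; with both equal to \<open>-1\<close> it makes all products vanish, and the zero
multiplication is graded as well.\<close>

lemma graded_if_involution:
  assumes fr: "frame u v" and g: "g \<in> algebra_aut scale mult" "g u = comb u v t 0" "g v = comb u v 0 w"
    and t: "t ^ 2 = 1" "w ^ 2 = 1" "t \<noteq> 1 \<or> w \<noteq> 1"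
  shows "\<exists>u v a b c d. graded_frame u v a b c d"
proof -
  obtain p1 p2 q1 q2 r1 r2 s1 s2 where tab: "mult u u = comb u v p1 p2" "mult u v = comb u v q1 q2"
    "mult v u = comb u v r1 r2" "mult v v = comb u v s1 s2" using fr by (metis frameE)
  have lin: "g (comb u v a b) = comb u v (a * t) (b * w)" for a b
    by (simp add: aut_comb[OF g(1)] g(2,3) comb_comb)
  note hom = aut_mult[OF g(1)]
  have "p1 * t = t * t * p1" "p2 * w = t * t * p2" "q1 * t = t * w * q1" "q2 * w = t * w * q2"
    "r1 * t = t * w * r1" "r2 * w = t * w * r2" "s1 * t = w * w * s1" "s2 * w = w * w * s2"
    using hom[of u u] hom[of u v] hom[of v u] hom[of v v]
    by (simp_all add: tab lin g mult_comb comb_add comb_scale frame_eq_iff[OF fr] algebra_simps)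
  note eqs = this
  have "t = 1 \<or> t = -1" "w = 1 \<or> w = -1" using t by (auto simp: power2_eq_1_iff)
  then consider "t = 1" "w = -1" | "t = -1" "w = 1" | "t = -1" "w = -1" using t by auto
  then show ?thesis
  proof cases
    case 1
    then have "graded_frame v u s1 r2 q2 p1"
      using eqs frame_swap[OF fr] tab by (simp add: graded_frame_def comb_def)
    then show ?thesis by blast
  next
    case 2
    then have "graded_frame u v p2 q1 r1 s2"
      using eqs fr tab by (simp add: graded_frame_def)
    then show ?thesis by blast
  next
    case 3
    then have "graded_frame u v 0 0 0 0"
      using eqs fr tab by (simp add: graded_frame_def)
    then show ?thesis by blast
  qed
qed

text \<open>Comparing eigenvalues leaves only \<open>uu = p v\<close> and \<open>vv = s u\<close>. If one of them vanishes the frame is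
already graded. Otherwise \<open>k\<^sup>3 = p / s\<close> makes \<open>u \<mapsto> k v\<close>, \<open>v \<mapsto> u / k\<close> an automorphism, whose
eigenvectors \<open>u - k v\<close> and \<open>u + k v\<close> are the odd and the even basis vector.\<close>

lemma graded_if_torus:
  assumes fr: "frame u v" and g: "g \<in> algebra_aut scale mult" "g u = comb u v t 0" "g v = comb u v 0 w"
    and t: "t * w = 1" "t ^ 2 \<noteq> 1"
  shows "\<exists>u v a b c d. graded_frame u v a b c d"
proof -
  obtain p1 p2 q1 q2 r1 r2 s1 s2 where tab: "mult u u = comb u v p1 p2" "mult u v = comb u v q1 q2"
    "mult v u = comb u v r1 r2" "mult v v = comb u v s1 s2" using fr by (metis frameE)
  have lin: "g (comb u v a b) = comb u v (a * t) (b * w)" for a b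
    by (simp add: aut_comb[OF g(1)] g(2,3) comb_comb)
  note hom = aut_mult[OF g(1)]
  have "p1 * t = t * t * p1" "q1 * t = t * w * q1" "q2 * w = t * w * q2"
    "r1 * t = t * w * r1" "r2 * w = t * w * r2" "s2 * w = w * w * s2"
    using hom[of u u] hom[of u v] hom[of v u] hom[of v v]
    by (simp_all add: tab lin g mult_comb comb_add comb_scale frame_eq_iff[OF fr] algebra_simps)
  moreover have "t \<noteq> 0" "w \<noteq> 0" "t \<noteq> 1" "w \<noteq> 1" using t by auto
  ultimately have z: "p1 = 0" "q1 = 0" "q2 = 0" "r1 = 0" "r2 = 0" "s2 = 0" using t by auto
  show ?thesis
  proof (cases "p2 = 0 \<or> s1 = 0")
    case True
    then have "graded_frame u v p2 0 0 0 \<or> graded_frame v u s1 0 0 0"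
      using fr frame_swap[OF fr] tab z by (auto simp: graded_frame_def comb_def)
    then show ?thesis by blast
  next
    case False
    obtain k where k: "k ^ 3 = p2 / s1" using nth_root_exists[of 3 "p2 / s1"] by auto
    then have "k \<noteq> 0" "k * k * k * s1 = p2" using False by (auto simp: power3_eq_cube field_simps)
    have "graded_frame (comb u v 1 (- k)) (comb u v 1 k) (p2 / k) (- (p2 / k)) (- (p2 / k)) (p2 / k)"
      using fr \<open>k \<noteq> 0\<close> \<open>k * k * k * s1 = p2\<close>[symmetric]
      by (simp add: graded_frame_def frame_comb_iff mult_comb tab z comb_add comb_scale comb_comb frame_eq_iff)
    then show ?thesis by blast
  qed
qed


section \<open>Eigenvectors of an automorphism and symmetric forms\<close>

text \<open>The Jordan normal form of a \<open>2 \<times> 2\<close> matrix; in the nondiagonalisable case the first vector is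
scaled so that the off-diagonal entry is \<open>1\<close>.\<close>

lemma eigenframe:
  assumes g: "g \<in> algebra_aut scale mult"
  obtains u v t w where "frame u v" "t \<noteq> 0" "g u = comb u v t 0" "g v = comb u v 0 w \<or> g v = comb u v 1 t"
proof -
  obtain u v where fr: "frame u v" using dim_two by (rule frame_exists)
  have "\<exists>u v t. frame u v \<and> g u = comb u v t 0"
  proof -
    obtain x y z w where xy: "g u = comb u v x y" "g v = comb u v z w"
      and lin: "\<And>a b. g (comb u v a b) = comb u v (a * x + b * z) (a * y + b * w)"
      using autE[OF g fr] by metis
    show ?thesis
    proof (cases "y = 0")
      case True
      then show ?thesis using fr xy by blast
    next
      case False
      \<comment> \<open>The equation for \<open>k u + v\<close> to be an eigenvector; its eigenvalue is then \<open>k y + w\<close>.\<close>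
      then obtain k where k: "y * k ^ 2 + (w - x) * k - z = 0"
        using alg_closed_quadratic_root[of y "w - x" "- z"] by auto
      have "frame (comb u v k 1) (comb u v 1 0)" by (simp add: frame_comb_iff[OF fr])
      moreover have "g (comb u v k 1) = comb (comb u v k 1) (comb u v 1 0) (k * y + w) 0"
        unfolding lin comb_comb frame_eq_iff[OF fr] using k by (simp add: power2_eq_square algebra_simps)
      ultimately show ?thesis by blast
    qed
  qed
  then obtain u v t where fr: "frame u v" and gu: "g u = comb u v t 0" by blast
  obtain x y z w where xy: "g u = comb u v x y" "g v = comb u v z w" "x * w - y * z \<noteq> 0"
    using g fr by (rule autE)
  have "x = t" "y = 0" using xy gu by (simp_all add: frame_eq_iff[OF fr])
  then have "t \<noteq> 0" using xy by auto
  consider "w \<noteq> t" | "w = t" "z = 0" | "w = t" "z \<noteq> 0" by blast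
  then show thesis
  proof cases
    case 1
    \<comment> \<open>Adding \<open>c u\<close> to \<open>v\<close> makes it an eigenvector for \<open>w\<close>.\<close>
    define c where "c = z / (w - t)"
    have c: "c * t + z = w * c" using 1 by (simp add: c_def field_simps)
    have "g (comb u v c 1) = comb u (comb u v c 1) 0 w"
      by (simp add: aut_comb[OF g] gu xy(2) comb_comb frame_eq_iff[OF fr] c
          comb_comb[where x = 1 and y = 0, unfolded comb_fst[symmetric]])
    moreover have "frame u (comb u v c 1)"
      using frame_comb_iff[OF fr, of 1 0 c 1] by (simp add: comb_fst[symmetric])
    moreover have "g u = comb u (comb u v c 1) t 0" using gu by (simp add: comb_def)
    ultimately show thesis using \<open>t \<noteq> 0\<close> that by blast
  next
    case 2
    then show thesis using fr gu xy(2) \<open>t \<noteq> 0\<close> that by blast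
  next
    case 3
    have "frame (comb u v z 0) v"
      using frame_comb_iff[OF fr, of z 0 0 1] 3 by (simp add: comb_snd[symmetric])
    moreover have "g (comb u v z 0) = comb (comb u v z 0) v t 0"
      by (simp add: aut_comb[OF g] gu) (simp add: comb_def mult.commute)
    moreover have "g v = comb (comb u v z 0) v 1 t"
      using 3 by (simp add: xy(2)) (simp add: comb_def)
    ultimately show thesis using \<open>t \<noteq> 0\<close> that by blast
  qed
qed

lemma eigenvector_weights:
  assumes "frame u v" "bilinear_form scale \<phi>" "invariant_form scale mult \<phi>" "g \<in> algebra_aut scale mult"
    and "g u = comb u v t 0" "g v = comb u v z w"
  shows "t * t * \<phi> u u = \<phi> u u"
    and "t * z * \<phi> u u + t * w * \<phi> u v = \<phi> u v"
    and "z * z * \<phi> u u + z * w * \<phi> u v + w * z * \<phi> v u + w * w * \<phi> v v = \<phi> v v"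
proof -
  have i: "\<phi> (g x) (g y) = \<phi> x y" for x y using assms by (simp add: invariant_form_def)
  show "t * t * \<phi> u u = \<phi> u u"
    and "t * z * \<phi> u u + t * w * \<phi> u v = \<phi> u v"
    and "z * z * \<phi> u u + z * w * \<phi> u v + w * z * \<phi> v u + w * w * \<phi> v v = \<phi> v v"
    using i[of u u] i[of u v] i[of v v] assms(5,6) by (simp_all add: form_comb[OF assms(2)])
qed

text \<open>For a Jordan block, invariance forces \<open>\<phi> u u = \<phi> u v = 0\<close>. For a diagonal automorphism the Gram
matrix is multiplied entrywise by \<open>t\<^sup>2\<close>, \<open>tw\<close>, \<open>w\<^sup>2\<close>, so nondegeneracy needs \<open>tw = 1\<close> or \<open>t\<^sup>2 = w\<^sup>2 = 1\<close>;
both cases have been turned into gradings.\<close>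

lemma symmetric_form_imp_graded:
  assumes nontriv: "algebra_aut scale mult \<noteq> {id}"
    and \<phi>: "bilinear_form scale \<phi>" "invariant_form scale mult \<phi>" "nondegenerate_form \<phi>"
    and sym: "symmetric_form \<phi>"
  shows "\<exists>u v a b c d. graded_frame u v a b c d"
proof -
  obtain g where g: "g \<in> algebra_aut scale mult" "g \<noteq> id" using nontrivial_aut_obtain[OF nontriv] .
  obtain u v t w where fr: "frame u v" and t: "t \<noteq> 0" and gu: "g u = comb u v t 0"
    and gv: "g v = comb u v 0 w \<or> g v = comb u v 1 t" using g(1) by (rule eigenframe)
  have row: "\<phi> u u \<noteq> 0 \<or> \<phi> u v \<noteq> 0" "\<phi> v v \<noteq> 0 \<or> \<phi> v u \<noteq> 0"
    using nondegenerate_row fr frame_swap \<phi> by blast+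
  have vu: "\<phi> v u = \<phi> u v" using sym by (simp add: symmetric_form_def)
  from gv show ?thesis
  proof
    assume gv: "g v = comb u v 1 t"
    have A: "t * t * \<phi> u u = \<phi> u u" "t * \<phi> u u + t * t * \<phi> u v = \<phi> u v"
      "\<phi> u u + 2 * t * \<phi> u v + t * t * \<phi> v v = \<phi> v v"
      using eigenvector_weights[OF fr \<phi>(1,2) g(1) gu gv] vu by (simp_all add: algebra_simps)
    have "\<phi> u u = 0 \<and> \<phi> u v = 0"
    proof (cases "t * t = 1")
      case True
      then have "\<phi> u u = 0" using A(2) t by simp
      then show ?thesis using A(3) True t by simp
    next
      case False
      then have "\<phi> u u = 0" using A(1) by simp
      then show ?thesis using A(2) False by simp
    qed
    then show ?thesis using row by simp
  next
    assume gv: "g v = comb u v 0 w"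
    have A: "t * t * \<phi> u u = \<phi> u u" "t * w * \<phi> u v = \<phi> u v" "w * w * \<phi> v v = \<phi> v v"
      using eigenvector_weights[OF fr \<phi>(1,2) g(1) gu gv] by simp_all
    have nid: "t \<noteq> 1 \<or> w \<noteq> 1"
      using not_id_on_frame[OF fr g] gu gv by (auto simp: comb_fst[symmetric] comb_snd[symmetric])
    show ?thesis
    proof (cases "t * w = 1 \<and> t ^ 2 \<noteq> 1")
      case True
      then show ?thesis using graded_if_torus[OF fr g(1) gu gv] by blast
    next
      case False
      have "t ^ 2 = 1 \<and> w ^ 2 = 1"
      proof (cases "t * w = 1")
        case True
        then have "t ^ 2 = 1" using False by simp
        moreover have "t ^ 2 * w ^ 2 = 1" using True by (simp flip: power_mult_distrib)
        ultimately show ?thesis by simp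
      next
        case False
        then show ?thesis using A row vu by (auto simp: power2_eq_square)
      qed
      then show ?thesis using graded_if_involution[OF fr g(1) gu gv] nid by blast
    qed
  qed
qed

section \<open>Skew-symmetric forms\<close>

text \<open>The reflection \<open>u \<mapsto> - u\<close>, \<open>v \<mapsto> v\<close> of a graded frame has determinant \<open>-1\<close> and so changes the sign of
a skew-symmetric form.\<close>

lemma skew_form_not_graded:
  assumes gr: "graded_frame u v a b c d"
    and \<phi>: "bilinear_form scale \<phi>" "invariant_form scale mult \<phi>" "nondegenerate_form \<phi>"
    and skew: "skew_symmetric_form \<phi>"
  shows False
proof -
  have fr: "frame u v" using gr by (simp add: graded_frame_def)
  obtain g where g: "g \<in> algebra_aut scale mult" "g u = comb u v (- 1) 0" "g v = comb u v 0 1"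
    by (rule graded_diagonal_aut[OF gr, of "- 1" 1]) simp_all
  have "\<phi> u v = 0"
    using eigenvector_weights(2)[OF fr \<phi>(1,2) g] by (intro eq_neg_self_imp_zero) simp
  moreover have "\<phi> u u = 0"
    using skew by (intro eq_neg_self_imp_zero) (metis skew_symmetric_form_def)
  ultimately show False using nondegenerate_row[OF fr \<phi>(1,3)] by simp
qed

text \<open>A diagonal \<open>g\<close> would have determinant \<open>tw = 1\<close> and hence lead to a grading, so \<open>g\<close> is a Jordan block with
\<open>t\<^sup>2 = 1\<close>. For \<open>t = - 1\<close> the products would be generalised eigenvectors of \<open>g\<close> for \<open>t\<^sup>2 = 1\<close>, of
which there are none but \<open>0\<close>, so the multiplication would vanish; for \<open>t = 1\<close> comparing coefficients gives the stated products. The fixed vector of \<open>g\<close> is \<open>v\<close>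
in the conclusion, but \<open>u\<close> inside the proof.\<close>

lemma skew_form_imp_triangular:
  assumes nontriv: "algebra_aut scale mult \<noteq> {id}"
    and \<phi>: "bilinear_form scale \<phi>" "invariant_form scale mult \<phi>" "nondegenerate_form \<phi>"
    and skew: "skew_symmetric_form \<phi>"
  obtains u v p q r where "frame u v" "mult u u = comb u v (q + r) p" "mult u v = comb u v 0 q"
    "mult v u = comb u v 0 r" "mult v v = comb u v 0 0"
proof -
  note not_graded = skew_form_not_graded[OF _ \<phi> skew]
  obtain g where g: "g \<in> algebra_aut scale mult" "g \<noteq> id" using nontrivial_aut_obtain[OF nontriv] .
  obtain u v t w where fr: "frame u v" and t: "t \<noteq> 0" and gu: "g u = comb u v t 0"
    and gv: "g v = comb u v 0 w \<or> g v = comb u v 1 t" using g(1) by (rule eigenframe)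
  have uu: "\<phi> u u = 0"
    using skew by (intro eq_neg_self_imp_zero) (metis skew_symmetric_form_def)
  then have uv: "\<phi> u v \<noteq> 0" using nondegenerate_row[OF fr \<phi>(1,3)] by simp
  have False if gv: "g v = comb u v 0 w"
  proof -
    have tw: "t * w = 1" using eigenvector_weights(2)[OF fr \<phi>(1,2) g(1) gu gv] uu uv by simp
    have nid: "t \<noteq> 1 \<or> w \<noteq> 1"
      using not_id_on_frame[OF fr g] gu gv by (auto simp: comb_fst[symmetric] comb_snd[symmetric])
    show False
    proof (cases "t ^ 2 = 1")
      case True
      moreover have "t ^ 2 * w ^ 2 = 1" using tw by (simp flip: power_mult_distrib)
      ultimately show False using graded_if_involution[OF fr g(1) gu gv] nid not_graded by auto
    next
      case False
      then show False using graded_if_torus[OF fr g(1) gu gv tw] not_graded by blast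
    qed
  qed
  then have gv: "g v = comb u v 1 t" using gv by blast
  have "t * t = 1" using eigenvector_weights(2)[OF fr \<phi>(1,2) g(1) gu gv] uu uv by simp
  obtain p1 p2 q1 q2 r1 r2 s1 s2 where tab: "mult u u = comb u v p1 p2" "mult u v = comb u v q1 q2"
    "mult v u = comb u v r1 r2" "mult v v = comb u v s1 s2" using fr by (metis frameE)
  have lin: "g (comb u v a b) = comb u v (a * t + b) (b * t)" for a b
    by (simp add: aut_comb[OF g(1)] gu gv comb_comb)
  note hom = aut_mult[OF g(1)]
  have eqs: "p1 * t + p2 = t * t * p1" "p2 * t = t * t * p2"
    "q1 * t + q2 = t * p1 + t * t * q1" "q2 * t = t * p2 + t * t * q2"
    "r1 * t + r2 = t * p1 + t * t * r1" "r2 * t = t * p2 + t * t * r2"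
    "s1 * t + s2 = p1 + t * q1 + t * r1 + t * t * s1" "s2 * t = p2 + t * q2 + t * r2 + t * t * s2"
    using hom[of u u] hom[of u v] hom[of v u] hom[of v v]
    by (simp_all add: tab lin gu gv mult_comb comb_add comb_scale frame_eq_iff[OF fr] algebra_simps)
  have "t = 1 \<or> t = - 1" using \<open>t * t = 1\<close> by (simp add: square_eq_1_iff)
  moreover have "t \<noteq> - 1"
  proof
    assume "t = - 1"
    then have "2 * p2 = 0" "2 * p1 = p2" "2 * q2 = p2" "2 * q1 = p1 + q2" "2 * r2 = p2" "2 * r1 = p1 + r2"
      "2 * s2 = q2 + r2 - p2" "2 * s1 = q1 + r1 + s2 - p1"
      using eqs by (simp_all add: algebra_simps)
    then have "graded_frame u v 0 0 0 0"
      using fr tab by (simp add: graded_frame_def)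
    then show False by (rule not_graded)
  qed
  ultimately have "t = 1" by blast
  then have "p2 = 0" "q2 = p1" "r2 = p1" "p2 + q2 + r2 = 0" "s2 = p1 + q1 + r1" using eqs by simp_all
  moreover from this have "2 * p1 = 0" by simp
  ultimately have z: "p1 = 0" "p2 = 0" "q2 = 0" "r2 = 0" "s2 = r1 + q1" by simp_all
  show thesis
    by (rule that[of v u r1 q1 s1]) (use fr tab z in \<open>auto simp: frame_swap comb_def\<close>)
qed

text \<open>If \<open>p = 0\<close>, or if \<open>q = r = 0\<close>, the triangular products are graded. In the remaining cases
\<open>u\<close> is scaled to make \<open>q + r = 1\<close>, or \<open>q = 1\<close> if \<open>q + r = 0\<close>, and \<open>v\<close> is scaled to make \<open>p = 1\<close>.\<close>

lemma skew_form_imp_A1_A2: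
  assumes nontriv: "algebra_aut scale mult \<noteq> {id}"
    and \<phi>: "bilinear_form scale \<phi>" "invariant_form scale mult \<phi>" "nondegenerate_form \<phi>"
    and skew: "skew_symmetric_form \<phi>"
  shows "(\<exists>\<alpha>. algebra_isomorphic scale mult (*s) (alg_A1 \<alpha>)) \<or> algebra_isomorphic scale mult (*s) alg_A2"
proof -
  note not_graded = skew_form_not_graded[OF _ \<phi> skew]
  obtain u v p q r where fr: "frame u v" and tab: "mult u u = comb u v (q + r) p" "mult u v = comb u v 0 q"
    "mult v u = comb u v 0 r" "mult v v = comb u v 0 0"
    using skew_form_imp_triangular[OF nontriv \<phi> skew] .
  have p: "p \<noteq> 0"
  proof
    assume "p = 0"
    then have "graded_frame v u 0 r q (q + r)"
      using fr tab by (simp add: graded_frame_def frame_swap comb_def)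
    then show False by (rule not_graded)
  qed
  show ?thesis
  proof (cases "q + r = 0")
    case False
    define k where "k = 1 / (q + r)"
    have k: "k \<noteq> 0" "k * (q + r) = 1" using False by (simp_all add: k_def)
    then have r: "k * (k * (k * (p * q))) + k * (k * (k * (p * r))) = k * (k * p)" by algebra
    have "frame (comb u v k 0) (comb u v 0 (k * k * p))" (is "frame ?u ?v")
      using k p by (simp add: frame_comb_iff[OF fr])
    then have "algebra_isomorphic scale mult (*s) (alg_A1 (k * q))"
      unfolding alg_A1_def
      using k r by (intro isomorphic_tableI[of ?u ?v])
        (simp_all add: mult_comb tab comb_add comb_scale comb_comb frame_eq_iff[OF fr] axis_def algebra_simps)
    then show ?thesis by blast
  next
    case True
    have q: "q \<noteq> 0"
    proof
      assume "q = 0"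
      then have "graded_frame u v p 0 0 0"
        using fr tab True by (simp add: graded_frame_def)
      then show False by (rule not_graded)
    qed
    have r: "r = - q" using True by (simp add: eq_neg_iff_add_eq_0 add.commute)
    define k where "k = 1 / q"
    have k: "k \<noteq> 0" "k * q = 1" using q by (simp_all add: k_def)
    have "frame (comb u v k 0) (comb u v 0 (k * k * p))" (is "frame ?u ?v")
      using k p by (simp add: frame_comb_iff[OF fr])
    then have "algebra_isomorphic scale mult (*s) alg_A2"
      unfolding alg_A2_def
      using k r by (intro isomorphic_tableI[of ?u ?v])
        (simp_all add: mult_comb tab comb_add comb_scale comb_comb frame_eq_iff[OF fr] axis_def algebra_simps)
    then show ?thesis by blast
  qed
qed


text \<open>Such automorphisms have determinant \<open>1\<close>, so the determinant form of the frame is invariant.\<close>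

lemma unimodular_aut_skew_form:
  assumes fr: "frame u v"
    and uni: "\<And>g. g \<in> algebra_aut scale mult \<Longrightarrow> \<exists>y. g u = comb u v 1 y \<and> g v = v"
  shows "\<exists>\<phi>. bilinear_form scale \<phi> \<and> skew_symmetric_form \<phi> \<and> invariant_form scale mult \<phi> \<and> nondegenerate_form \<phi>"
proof -
  obtain \<phi> where \<phi>: "bilinear_form scale \<phi>"
    and f: "\<And>a b c d. \<phi> (comb u v a b) (comb u v c d) = a * c * 0 + a * d * 1 + b * c * (- 1) + b * d * 0"
    using form_exists[OF fr, of 0 1 "- 1" 0] by blast
  have uv: "\<phi> u u = 0" "\<phi> u v = 1" "\<phi> v u = - 1" "\<phi> v v = 0"
    using f[of 1 0 1 0] f[of 1 0 0 1] f[of 0 1 1 0] f[of 0 1 0 1]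
    by (simp_all add: comb_fst[symmetric] comb_snd[symmetric])
  have "skew_symmetric_form \<phi>"
    unfolding skew_symmetric_form_def
  proof (intro allI)
    fix x y
    obtain a b c d where "x = comb u v a b" "y = comb u v c d" using fr by (metis frameE)
    then show "\<phi> x y = - \<phi> y x" by (simp add: f algebra_simps)
  qed
  moreover have "invariant_form scale mult \<phi>"
  proof (rule invariant_if_on_frame[OF fr \<phi>])
    fix g assume "g \<in> algebra_aut scale mult"
    then obtain y where g: "g u = comb u v 1 y" "g v = comb u v 0 1"
      using uni by (metis comb_snd)
    then show "\<phi> (g u) (g u) = \<phi> u u \<and> \<phi> (g u) (g v) = \<phi> u v \<and> \<phi> (g v) (g u) = \<phi> v u \<and> \<phi> (g v) (g v) = \<phi> v v"
      by (simp only: g f uv) simp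
  qed
  moreover have "nondegenerate_form \<phi>" by (rule nondegenerate_if_det[OF fr _ f]) simp
  ultimately show ?thesis using \<phi> by blast
qed

text \<open>In both algebras the vectors of square zero are the multiples of \<open>v\<close>, so automorphisms are
triangular, and the images of the products pin both diagonal entries to \<open>1\<close>.\<close>

lemma A1_A2_imp_skew_form:
  assumes "algebra_isomorphic scale mult (*s) (alg_A1 \<alpha>) \<or> algebra_isomorphic scale mult (*s) alg_A2"
  shows "\<exists>\<phi>. bilinear_form scale \<phi> \<and> skew_symmetric_form \<phi> \<and> invariant_form scale mult \<phi> \<and> nondegenerate_form \<phi>"
  using assms
proof
  assume "algebra_isomorphic scale mult (*s) (alg_A1 \<alpha>)"
  then obtain u v where fr: "frame u v" and tab: "mult u u = comb u v 1 1" "mult u v = comb u v 0 \<alpha>"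
    "mult v u = comb u v 0 (1 - \<alpha>)" "mult v v = comb u v 0 0"
    by (auto simp: alg_A1_def isomorphic_table_iff axis_def)
  show ?thesis
  proof (rule unimodular_aut_skew_form[OF fr])
    fix g assume "g \<in> algebra_aut scale mult"
    then obtain x y z w where g: "g u = comb u v x y" "g v = comb u v z w" "x * w - y * z \<noteq> 0"
      "\<And>a b. g (comb u v a b) = comb u v (a * x + b * z) (a * y + b * w)"
      and hom: "\<And>t t'. g (mult t t') = mult (g t) (g t')" using fr by (rule autE) blast
    have "z * z = 0" "x * x = x + z" "y + w = x * x + x * y * \<alpha> + y * x * (1 - \<alpha>)"
      using hom[of v v] hom[of u u]
      by (simp_all add: tab g mult_comb comb_add comb_scale frame_eq_iff[OF fr] algebra_simps)
    then have "z = 0" "x = 1" "w = 1" using g(3) by (auto simp: algebra_simps)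
    then show "\<exists>y. g u = comb u v 1 y \<and> g v = v" using g by (auto simp: comb_snd[symmetric])
  qed
next
  assume "algebra_isomorphic scale mult (*s) alg_A2"
  then obtain u v where fr: "frame u v" and tab: "mult u u = comb u v 0 1" "mult u v = comb u v 0 1"
    "mult v u = comb u v 0 (- 1)" "mult v v = comb u v 0 0"
    by (auto simp: alg_A2_def isomorphic_table_iff axis_def)
  show ?thesis
  proof (rule unimodular_aut_skew_form[OF fr])
    fix g assume "g \<in> algebra_aut scale mult"
    then obtain x y z w where g: "g u = comb u v x y" "g v = comb u v z w" "x * w - y * z \<noteq> 0"
      "\<And>a b. g (comb u v a b) = comb u v (a * x + b * z) (a * y + b * w)"
      and hom: "\<And>t t'. g (mult t t') = mult (g t) (g t')" using fr by (rule autE) blast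
    have "z * z = 0" "w = x * x" "w + y * z = x * w"
      using hom[of v v] hom[of u u] hom[of u v]
      by (simp_all add: tab g mult_comb comb_add comb_scale frame_eq_iff[OF fr] algebra_simps)
    then have "z = 0" "x = 1" "w = 1" using g(3) by auto
    then show "\<exists>y. g u = comb u v 1 y \<and> g v = v" using g by (auto simp: comb_snd[symmetric])
  qed
qed

section \<open>Symmetric forms on graded algebras\<close>

text \<open>The hypotheses say that \<open>u \<mapsto> x u + y v\<close>, \<open>v \<mapsto> z u + w v\<close> is an automorphism of the graded algebra with
\<open>a = 1\<close>, and the conclusion that it preserves \<open>diag(1, q)\<close>. If \<open>y = 0\<close> the automorphism is
\<open>u \<mapsto> \<plusminus>u\<close>, \<open>v \<mapsto> v\<close>, which is orthogonal for every \<open>q\<close>. If \<open>y \<noteq> 0\<close>, the even parts of the images of \<open>uv\<close> and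
\<open>vu\<close> coincide, so \<open>b = c\<close>; the equations then exclude \<open>b = 0\<close> and determine \<open>x\<^sup>2 = 1/4\<close> and \<open>w = \<plusminus>1/2\<close>. The value \<open>w = 1/2\<close>
gives determinant zero, and \<open>w = - 1/2\<close> gives \<open>b y\<^sup>2 = 3/4\<close>: a rotation by a third of a turn,
or such a rotation followed by the reflection, with respect to \<open>diag(1, b)\<close>. This is why \<open>q = b\<close>; the value
\<open>q = 1\<close> for \<open>b = 0\<close> only avoids a degenerate form.\<close>

lemma orthogonal_if_aut_equations:
  fixes x y z w b c d :: "'f"
  assumes det: "x * w - y * z \<noteq> 0" and nz: "\<not> (b = 0 \<and> c = 0 \<and> d = 0)"
    and uu: "x * y * (b + c) = z" "x ^ 2 + d * y ^ 2 = w"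
    and uv: "x * w * b + y * z * c = b * x" "x * z + d * y * w = b * y"
    and vu: "y * z * b + x * w * c = c * x" "x * z + d * y * w = c * y"
    and vv: "z * w * (b + c) = d * z" "z ^ 2 + d * w ^ 2 = d * w"
    and q: "q = (if b = 0 then 1 else b)"
  shows "x ^ 2 + q * y ^ 2 = 1" "x * z + q * y * w = 0" "z ^ 2 + q * w ^ 2 = q"
proof -
  have "x ^ 2 + q * y ^ 2 = 1 \<and> x * z + q * y * w = 0 \<and> z ^ 2 + q * w ^ 2 = q"
  proof (cases "y = 0")
    case True
    then have z: "z = 0" "w = x ^ 2" using uu by auto
    then have "x \<noteq> 0" "w \<noteq> 0" using det by auto
    then have "w = 1" using nz uv(1) vu(1) vv(2) z by (auto simp: power2_eq_square)
    then show ?thesis using True z by simp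
  next
    case y: False
    then have "c = b" using uv vu by simp
    have b: "b \<noteq> 0"
    proof
      assume b: "b = 0"
      then have "d \<noteq> 0" "z = 0" using nz \<open>c = b\<close> uu by auto
      then have "w = 0" using uv(2) y b by simp
      then show False using det \<open>z = 0\<close> by simp
    qed
    have z: "z = 2 * b * x * y" using uu(1) \<open>c = b\<close> by (simp add: algebra_simps)
    then have x: "x \<noteq> 0" using det by auto
    then have "z \<noteq> 0" using z b y by simp
    have d: "d = 2 * b * w" using vv(1) \<open>z \<noteq> 0\<close> \<open>c = b\<close> by (simp add: algebra_simps)
    have "b * x * (w + 2 * b * y ^ 2) = b * x * 1"
      using uv(1) by (simp add: z \<open>c = b\<close> power2_eq_square algebra_simps)
    then have e1: "w + 2 * b * y ^ 2 = 1" using b x by simp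
    have "b * y * (2 * x ^ 2 + 2 * w ^ 2) = b * y * 1"
      using uv(2) by (simp add: z d power2_eq_square algebra_simps)
    then have e2: "2 * x ^ 2 + 2 * w ^ 2 = 1" using b y by simp
    have e3: "x ^ 2 + 2 * b * w * y ^ 2 = w" using uu(2) by (simp add: d)
    have "x ^ 2 = w ^ 2" using e1 e3 by algebra
    then have "4 * w ^ 2 = 1" "4 * x ^ 2 = 1" using e2 by simp_all
    then have "(2 * w - 1) * (2 * w + 1) = 0" by algebra
    moreover have "2 * w - 1 \<noteq> 0"
    proof
      assume "2 * w - 1 = 0"
      then have "2 * (x * w - y * z) = 0" using e1 z by algebra
      then show False using det by simp
    qed
    ultimately have "2 * w = - 1" by (simp add: eq_neg_iff_add_eq_0)
    then have w: "w = - 1 / 2" and "4 * (b * y ^ 2) = 3"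
      using e1 by (simp add: field_simps, algebra)
    then have by2: "b * y ^ 2 = 3 / 4" by (simp add: field_simps)
    have x2: "x ^ 2 = 1 / 4" using \<open>4 * x ^ 2 = 1\<close> by (simp add: field_simps)
    have "x * z = 2 * b * y * x ^ 2" "z ^ 2 = 4 * b * x ^ 2 * (b * y ^ 2)"
      by (simp_all add: z power2_eq_square)
    then have xz: "x * z = b * y / 2" "z ^ 2 = 3 * b / 4" by (simp_all add: x2 by2)
    have bw: "b * y * w = - (b * y / 2)" "b * w ^ 2 = b / 4" by (simp_all add: w power_divide)
    have "q = b" using b q by simp
    then show ?thesis by (simp add: x2 by2 xz bw)
  qed
  then show "x ^ 2 + q * y ^ 2 = 1" "x * z + q * y * w = 0" "z ^ 2 + q * w ^ 2 = q" by auto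
qed

lemma normalised_graded_imp_symmetric_form:
  assumes gr: "graded_frame u v 1 b c d" and nz: "\<not> (b = 0 \<and> c = 0 \<and> d = 0)"
  shows "\<exists>\<phi>. bilinear_form scale \<phi> \<and> symmetric_form \<phi> \<and> invariant_form scale mult \<phi> \<and> nondegenerate_form \<phi>"
proof -
  define q where "q = (if b = 0 then 1 else b)"
  have "q \<noteq> 0" by (simp add: q_def)
  have fr: "frame u v" and tab: "mult u u = comb u v 0 1" "mult u v = comb u v b 0"
    "mult v u = comb u v c 0" "mult v v = comb u v 0 d"
    using gr by (simp_all add: graded_frame_def)
  obtain \<phi> where \<phi>: "bilinear_form scale \<phi>"
    and f: "\<And>a b c d. \<phi> (comb u v a b) (comb u v c d) = a * c * 1 + a * d * 0 + b * c * 0 + b * d * q"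
    using form_exists[OF fr, of 1 0 0 q] by blast
  have uv: "\<phi> u u = 1" "\<phi> u v = 0" "\<phi> v u = 0" "\<phi> v v = q"
    using f[of 1 0 1 0] f[of 1 0 0 1] f[of 0 1 1 0] f[of 0 1 0 1]
    by (simp_all add: comb_fst[symmetric] comb_snd[symmetric])
  have "symmetric_form \<phi>"
    unfolding symmetric_form_def
  proof (intro allI)
    fix x y
    obtain a b c d where "x = comb u v a b" "y = comb u v c d" using fr by (metis frameE)
    then show "\<phi> x y = \<phi> y x" by (simp add: f algebra_simps)
  qed
  moreover have "invariant_form scale mult \<phi>"
  proof (rule invariant_if_on_frame[OF fr \<phi>])
    fix g assume "g \<in> algebra_aut scale mult"
    then obtain x y z w where g: "g u = comb u v x y" "g v = comb u v z w" "x * w - y * z \<noteq> 0"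
      "\<And>a b. g (comb u v a b) = comb u v (a * x + b * z) (a * y + b * w)"
      and hom: "\<And>t t'. g (mult t t') = mult (g t) (g t')" using fr by (rule autE) blast
    note expand = tab g mult_comb comb_add comb_scale frame_eq_iff[OF fr] power2_eq_square
    have uu: "x * y * (b + c) = z" "x ^ 2 + d * y ^ 2 = w"
      using hom[of u u] by (simp_all add: expand algebra_simps)
    have uv: "x * w * b + y * z * c = b * x" "x * z + d * y * w = b * y"
      using hom[of u v] by (simp_all add: expand algebra_simps)
    have vu: "y * z * b + x * w * c = c * x" "x * z + d * y * w = c * y"
      using hom[of v u] by (simp_all add: expand algebra_simps)
    have vv: "z * w * (b + c) = d * z" "z ^ 2 + d * w ^ 2 = d * w"
      using hom[of v v] by (simp_all add: expand algebra_simps)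
    have "x ^ 2 + q * y ^ 2 = 1" "x * z + q * y * w = 0" "z ^ 2 + q * w ^ 2 = q"
      by (fact orthogonal_if_aut_equations[OF g(3) nz uu uv vu vv q_def])+
    then show "\<phi> (g u) (g u) = \<phi> u u \<and> \<phi> (g u) (g v) = \<phi> u v \<and> \<phi> (g v) (g u) = \<phi> v u \<and> \<phi> (g v) (g v) = \<phi> v v"
      unfolding g(1,2) f \<open>\<phi> u u = 1\<close> \<open>\<phi> u v = 0\<close> \<open>\<phi> v u = 0\<close> \<open>\<phi> v v = q\<close>
      by (simp add: power2_eq_square algebra_simps)
  qed
  moreover have "nondegenerate_form \<phi>" by (rule nondegenerate_if_det[OF fr _ f]) (simp add: \<open>q \<noteq> 0\<close>)
  ultimately show ?thesis using \<phi> by blast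
qed

lemma graded_imp_symmetric_form:
  assumes "graded_frame u v a b c d" "a \<noteq> 0" "\<not> (b = 0 \<and> c = 0 \<and> d = 0)"
  shows "\<exists>\<phi>. bilinear_form scale \<phi> \<and> symmetric_form \<phi> \<and> invariant_form scale mult \<phi> \<and> nondegenerate_form \<phi>"
  by (rule normalised_graded_imp_symmetric_form, rule graded_frame_rescale[OF assms(1), of 1 a])
    (use assms in auto)

lemma symmetric_form_iff_graded:
  assumes "algebra_aut scale mult \<noteq> {id}"
  shows "(\<exists>\<phi>. bilinear_form scale \<phi> \<and> symmetric_form \<phi> \<and> invariant_form scale mult \<phi> \<and> nondegenerate_form \<phi>)
    \<longleftrightarrow> (\<exists>u v a b c d. graded_frame u v a b c d \<and> a \<noteq> 0 \<and> \<not> (b = 0 \<and> c = 0 \<and> d = 0))"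
proof
  assume "\<exists>\<phi>. bilinear_form scale \<phi> \<and> symmetric_form \<phi> \<and> invariant_form scale mult \<phi> \<and> nondegenerate_form \<phi>"
  then obtain \<phi> where \<phi>: "bilinear_form scale \<phi>" "invariant_form scale mult \<phi>" "nondegenerate_form \<phi>"
    and sym: "symmetric_form \<phi>" by blast
  obtain u v a b c d where gr: "graded_frame u v a b c d"
    using symmetric_form_imp_graded[OF assms \<phi> sym] by blast
  show "\<exists>u v a b c d. graded_frame u v a b c d \<and> a \<noteq> 0 \<and> \<not> (b = 0 \<and> c = 0 \<and> d = 0)"
    using gr graded_frame_nontrivial[OF gr \<phi>] by blast
next
  assume "\<exists>u v a b c d. graded_frame u v a b c d \<and> a \<noteq> 0 \<and> \<not> (b = 0 \<and> c = 0 \<and> d = 0)"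
  then show "\<exists>\<phi>. bilinear_form scale \<phi> \<and> symmetric_form \<phi> \<and> invariant_form scale mult \<phi> \<and> nondegenerate_form \<phi>"
    using graded_imp_symmetric_form by blast
qed

section \<open>Graded frames in the listed algebras\<close>

lemma A4_0_iff_graded:
  "algebra_isomorphic scale mult (*s) alg_A4_0 \<longleftrightarrow> (\<exists>u v. graded_frame u v 1 1 (- 1) 0)"
  by (simp add: alg_A4_0_def isomorphic_table_iff graded_frame_def axis_def)

lemma C_0_iff_graded:
  "algebra_isomorphic scale mult (*s) (alg_C_0 \<alpha>) \<longleftrightarrow> (\<exists>u v. graded_frame u v 1 (1 - \<alpha>) \<alpha> 1)"
  by (simp add: alg_C_0_def isomorphic_table_iff graded_frame_def axis_def)

text \<open>The automorphism behind the grading is \<open>e\<^sub>1 \<mapsto> e\<^sub>1\<close>, \<open>e\<^sub>2 \<mapsto> e\<^sub>1 - e\<^sub>2\<close>, with odd eigenvector \<open>e\<^sub>1 - 2 e\<^sub>2\<close> and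
even eigenvector \<open>e\<^sub>1\<close>.\<close>

lemma D1_iff_graded:
  "algebra_isomorphic scale mult (*s) (alg_D1 \<alpha> (2 * \<alpha> - 1)) \<longleftrightarrow>
    (\<exists>u v. graded_frame u v (- 1) (1 - 2 * \<alpha>) (2 * \<alpha> - 1) 1)"
proof
  assume "algebra_isomorphic scale mult (*s) (alg_D1 \<alpha> (2 * \<alpha> - 1))"
  then obtain u v where "frame u v" "mult u u = comb u v 1 0" "mult u v = comb u v (1 - \<alpha>) (2 * \<alpha> - 1)"
    "mult v u = comb u v \<alpha> (1 - 2 * \<alpha>)" "mult v v = comb u v 0 0"
    by (auto simp: alg_D1_def isomorphic_table_iff axis_def)
  then have "graded_frame (comb u v 1 (- 2)) (comb u v 1 0) (- 1) (1 - 2 * \<alpha>) (2 * \<alpha> - 1) 1"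
    by (simp add: graded_frame_def frame_comb_iff mult_comb comb_add comb_scale comb_comb frame_eq_iff algebra_simps)
  then show "\<exists>u v. graded_frame u v (- 1) (1 - 2 * \<alpha>) (2 * \<alpha> - 1) 1" by blast
next
  assume "\<exists>u v. graded_frame u v (- 1) (1 - 2 * \<alpha>) (2 * \<alpha> - 1) 1"
  then obtain u v where gr: "graded_frame u v (- 1) (1 - 2 * \<alpha>) (2 * \<alpha> - 1) 1" by blast
  then show "algebra_isomorphic scale mult (*s) (alg_D1 \<alpha> (2 * \<alpha> - 1))"
    unfolding alg_D1_def
    by (intro isomorphic_tableI[of "comb u v 0 1" "comb u v (- 1 / 2) (1 / 2)"])
      (simp_all add: graded_frame_def axis_def frame_comb_iff mult_comb comb_add comb_scale comb_comb frame_eq_iff field_simps)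
qed

text \<open>The automorphism behind the grading exchanges \<open>e\<^sub>1\<close> and \<open>e\<^sub>2\<close>, with odd eigenvector \<open>e\<^sub>1 - e\<^sub>2\<close> and even
eigenvector \<open>e\<^sub>1 + e\<^sub>2\<close>.\<close>

lemma E1_iff_graded:
  "algebra_isomorphic scale mult (*s) (alg_E1 \<alpha> \<beta> \<beta> \<alpha>) \<longleftrightarrow>
    (\<exists>u v. graded_frame u v (1 - \<alpha> - \<beta>) (1 + \<alpha> - \<beta>) (1 - \<alpha> + \<beta>) (1 + \<alpha> + \<beta>))"
proof
  assume "algebra_isomorphic scale mult (*s) (alg_E1 \<alpha> \<beta> \<beta> \<alpha>)"
  then obtain u v where "frame u v" "mult u u = comb u v 1 0" "mult u v = comb u v \<alpha> \<beta>"
    "mult v u = comb u v \<beta> \<alpha>" "mult v v = comb u v 0 1"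
    by (auto simp: alg_E1_def isomorphic_table_iff axis_def)
  then have "graded_frame (comb u v 1 (- 1)) (comb u v 1 1) (1 - \<alpha> - \<beta>) (1 + \<alpha> - \<beta>) (1 - \<alpha> + \<beta>) (1 + \<alpha> + \<beta>)"
    by (simp add: graded_frame_def frame_comb_iff mult_comb comb_add comb_scale comb_comb frame_eq_iff algebra_simps)
  then show "\<exists>u v. graded_frame u v (1 - \<alpha> - \<beta>) (1 + \<alpha> - \<beta>) (1 - \<alpha> + \<beta>) (1 + \<alpha> + \<beta>)" by blast
next
  assume "\<exists>u v. graded_frame u v (1 - \<alpha> - \<beta>) (1 + \<alpha> - \<beta>) (1 - \<alpha> + \<beta>) (1 + \<alpha> + \<beta>)"
  then obtain u v where gr: "graded_frame u v (1 - \<alpha> - \<beta>) (1 + \<alpha> - \<beta>) (1 - \<alpha> + \<beta>) (1 + \<alpha> + \<beta>)" by blast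
  then show "algebra_isomorphic scale mult (*s) (alg_E1 \<alpha> \<beta> \<beta> \<alpha>)"
    unfolding alg_E1_def
    by (intro isomorphic_tableI[of "comb u v (1 / 2) (1 / 2)" "comb u v (- 1 / 2) (1 / 2)"])
      (simp_all add: graded_frame_def axis_def frame_comb_iff mult_comb comb_add comb_scale comb_comb frame_eq_iff field_simps)
qed

text \<open>So this family fills the gap left by the condition \<open>D \<noteq> 0\<close> on \<open>\<^bold>E\<^sub>1(\<gamma>, \<delta>, \<delta>, \<gamma>)\<close> at
\<open>\<gamma> + \<delta> = - 1\<close>.\<close>

lemma E3_diag_eq_E1: "alg_E3_diag \<alpha> = alg_E1 (\<alpha> - 1) (- \<alpha>) (- \<alpha>) (\<alpha> - 1 :: 'f)"
  by (simp add: alg_E3_diag_def alg_E1_def vec_eq_iff forall_2 axis_def)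

text \<open>Rescaling multiplies \<open>(b, c, d)\<close> by any \<open>m \<noteq> 0\<close>, while \<open>a\<close> can be given any nonzero value by a square
root. If \<open>b + c = 0\<close>, or \<open>b + c = d \<noteq> 0\<close>, scaling \<open>b\<close> or \<open>d\<close> to \<open>1\<close> yields \<open>\<^bold>A\<^sub>4(0)\<close>, \<open>\<^bold>D\<^sub>1\<close> or \<open>\<^bold>C\<close>; otherwise \<open>b + c\<close>
is scaled to \<open>2\<close>, the value it has in \<open>\<^bold>E\<^sub>1(\<alpha>, \<beta>, \<beta>, \<alpha>)\<close>, and \<open>d\<close> is then \<open>1 + \<alpha> + \<beta>\<close>.\<close>

lemma graded_imp_listed:
  assumes gr: "graded_frame u v a b c d" and a: "a \<noteq> 0" and nz: "\<not> (b = 0 \<and> c = 0 \<and> d = 0)"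
  shows "algebra_isomorphic scale mult (*s) alg_A4_0
      \<or> (\<exists>\<alpha>. algebra_isomorphic scale mult (*s) (alg_C_0 \<alpha>))
      \<or> (\<exists>\<alpha>. algebra_isomorphic scale mult (*s) (alg_D1 \<alpha> (2 * \<alpha> - 1)))
      \<or> (\<exists>\<alpha> \<beta>. \<alpha> + \<beta> \<noteq> 1 \<and> \<alpha> + \<beta> \<noteq> - 1 \<and> algebra_isomorphic scale mult (*s) (alg_E1 \<alpha> \<beta> \<beta> \<alpha>))
      \<or> (\<exists>\<alpha>. algebra_isomorphic scale mult (*s) (alg_E3_diag \<alpha>))"
proof -
  have normalise: "\<exists>u v. graded_frame u v a' (m * b) (m * c) (m * d)" if "m \<noteq> 0" "a' \<noteq> 0" for m a'
  proof -
    obtain k where k: "k ^ 2 = m * a' / a" using nth_root_exists[of 2 "m * a' / a"] by auto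
    then have "k \<noteq> 0" "m * a' = k ^ 2 * a" using that a by auto
    then show ?thesis using graded_frame_rescale[OF gr _ \<open>m \<noteq> 0\<close>] by blast
  qed
  consider (A4) "d = 0" "b + c = 0" | (E3) "d = 0" "b + c \<noteq> 0" | (D1) "d \<noteq> 0" "b + c = 0"
    | (C) "d \<noteq> 0" "b + c = d" | (E1) "d \<noteq> 0" "b + c \<noteq> 0" "b + c \<noteq> d" by blast
  then show ?thesis
  proof cases
    case A4
    then have "c = - b" "b \<noteq> 0" using nz by (auto simp: eq_neg_iff_add_eq_0 add.commute)
    then show ?thesis using normalise[of "1 / b" 1] A4 by (auto simp: A4_0_iff_graded)
  next
    case E3
    define m where "m = 2 / (b + c)"
    have m: "m \<noteq> 0" "m * c = 2 - m * b" using E3 by (auto simp: m_def field_simps)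
    define \<alpha> where "\<alpha> = m * b / 2"
    have "1 - (\<alpha> - 1) - (- \<alpha>) = 2" "1 + (\<alpha> - 1) - (- \<alpha>) = m * b" "1 - (\<alpha> - 1) + (- \<alpha>) = m * c"
      "1 + (\<alpha> - 1) + (- \<alpha>) = m * d"
      using m E3 by (simp_all add: \<alpha>_def)
    then have "algebra_isomorphic scale mult (*s) (alg_E3_diag \<alpha>)"
      unfolding E3_diag_eq_E1 E1_iff_graded using normalise[of m 2] m(1) by simp
    then show ?thesis by blast
  next
    case D1
    define \<alpha> where "\<alpha> = (1 - b / d) / 2"
    have "2 * \<alpha> = 1 - b / d" by (simp add: \<alpha>_def)
    then have "b / d = 1 - 2 * \<alpha>" "c = - b" using D1(2) by (simp_all add: eq_neg_iff_add_eq_0 add.commute)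
    then have "algebra_isomorphic scale mult (*s) (alg_D1 \<alpha> (2 * \<alpha> - 1))"
      unfolding D1_iff_graded using normalise[of "1 / d" "- 1"] D1 by simp
    then show ?thesis by blast
  next
    case C
    then have "b / d = 1 - c / d" by (simp add: field_simps)
    then have "algebra_isomorphic scale mult (*s) (alg_C_0 (c / d))"
      unfolding C_0_iff_graded using normalise[of "1 / d" "1"] C by simp
    then show ?thesis by blast
  next
    case E1
    define m where "m = 2 / (b + c)"
    have m0: "m \<noteq> 0" "m * (b + c) = 2"
      using E1 nonzero_eq_divide_eq[of "b + c" m 2] by (simp_all add: m_def)
    moreover have "m * d \<noteq> m * (b + c)" using m0(1) E1 by simp
    ultimately have m: "m \<noteq> 0" "m * c = 2 - m * b" "m * d \<noteq> 0" "m * d \<noteq> 2"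
      using E1 by (simp_all add: algebra_simps)
    \<comment> \<open>The solution of \<open>\<alpha> + \<beta> = m d - 1\<close>, \<open>\<alpha> - \<beta> = m b - 1\<close>.\<close>
    define \<alpha> \<beta> where "\<alpha> = (m * b + m * d - 2) / 2" and "\<beta> = (m * d - m * b) / 2"
    have "\<alpha> + \<beta> = m * d - 1" "\<alpha> - \<beta> = m * b - 1"
      by (simp_all add: \<alpha>_def \<beta>_def field_simps)
    moreover from this have "1 + \<alpha> - \<beta> = m * b" by (simp add: algebra_simps)
    moreover from this have "1 - \<alpha> + \<beta> = m * c"
      using m(2) diff_diff_eq2[of 2 "1 + \<alpha>" \<beta>] by simp
    ultimately have s: "\<alpha> + \<beta> = m * d - 1" "1 + \<alpha> - \<beta> = m * b" "1 - \<alpha> + \<beta> = m * c"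
      by blast+
    have s': "1 - \<alpha> - \<beta> = 2 - m * d" "1 + \<alpha> + \<beta> = m * d"
      using s(1) by (simp_all add: diff_diff_eq add.assoc)
    have "algebra_isomorphic scale mult (*s) (alg_E1 \<alpha> \<beta> \<beta> \<alpha>)"
      unfolding E1_iff_graded s(2,3) s' using normalise[of m "2 - m * d"] m by auto
    moreover have "\<alpha> + \<beta> \<noteq> 1" "\<alpha> + \<beta> \<noteq> - 1" using m s(1) by auto
    ultimately show ?thesis by blast
  qed
qed

end

section \<open>Parameter representatives\<close>

text \<open>The pair is fixed by the involution, hence alone in its orbit.\<close>

lemma diagonal_in_U:
  assumes "is_U \<U>"
  shows "(\<alpha>, 2 * \<alpha> - 1) \<in> \<U>"
proof -
  have "\<forall>x\<in>UNIV. \<exists>!r. r \<in> \<U> \<and> r \<in> (\<lambda>g. g x) ` {id, U_involution}"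
    using assms unfolding is_U_def orbit_representatives_def by (rule conjunct2)
  from bspec[OF this UNIV_I, of "(\<alpha>, 2 * \<alpha> - 1)"]
  obtain r where "r \<in> \<U>" "r \<in> (\<lambda>g. g (\<alpha>, 2 * \<alpha> - 1)) ` {id, U_involution}"
    by (elim ex1E conjE)
  moreover have "U_involution (\<alpha>, 2 * \<alpha> - 1) = (\<alpha>, 2 * \<alpha> - 1)" by (simp add: U_involution_def)
  ultimately show ?thesis by auto
qed

lemma symmetric_admissible_iff:
  "(\<alpha>, \<beta>, \<beta>, \<alpha>) \<in> admissible \<longleftrightarrow> \<alpha> + \<beta> \<noteq> 1 \<and> \<alpha> + \<beta> \<noteq> - 1"
proof -
  have "(\<alpha> + \<beta>) * (\<beta> + \<alpha>) - 1 = (\<alpha> + \<beta> - 1) * (\<alpha> + \<beta> + 1)" by (simp add: algebra_simps)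
  then have "(\<alpha> + \<beta>) * (\<beta> + \<alpha>) - 1 = 0 \<longleftrightarrow> \<alpha> + \<beta> = 1 \<or> \<alpha> + \<beta> = - 1"
    by (simp add: eq_neg_iff_add_eq_0)
  then show ?thesis
    by (auto simp: admissible_def param_D_def param_C1_def param_C2_def param_T_def add.commute)
qed

text \<open>The triple of \<open>(\<alpha>, \<beta>, \<beta>, \<alpha>)\<close> is \<open>(C, C, C\<^sub>3)\<close>. Its chosen representative is a permutation of it; if
\<open>C\<^sub>3 \<noteq> C\<close> and \<open>C\<^sub>3\<close> were not in the last place, the first two entries would differ while the third
equals one of them, against the side condition. So the triple represents itself.\<close>

lemma symmetric_in_V:
  assumes W: "is_V_tilde W" and "\<alpha> + \<beta> \<noteq> 1" "\<alpha> + \<beta> \<noteq> - 1"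
  shows "(\<alpha>, \<beta>, \<beta>, \<alpha>) \<in> V_of W"
proof -
  let ?t = "param_triple (\<alpha>, \<beta>, \<beta>, \<alpha>)"
  have adm: "(\<alpha>, \<beta>, \<beta>, \<alpha>) \<in> admissible" using assms by (simp add: symmetric_admissible_iff)
  have t12: "?t $ 1 = ?t $ 2" by (simp add: param_triple_def param_C1_def param_C2_def)
  obtain r where r: "r \<in> W" "r \<in> (\<lambda>g. g ?t) ` S3_action"
    using W adm unfolding is_V_tilde_def orbit_representatives_def by blast
  then obtain \<pi> :: "3 \<Rightarrow> 3" where \<pi>: "bij \<pi>" and r': "r = (\<chi> i. ?t $ inv \<pi> i)"
    by (auto simp: S3_action_def)
  \<comment> \<open>The entry \<open>C\<^sub>3\<close> sits at position \<open>\<pi> 3\<close>, and the other two entries agree.\<close>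
  have rs: "r $ i = (if i = \<pi> 3 then ?t $ 3 else ?t $ 1)" for i
  proof (cases "i = \<pi> 3")
    case True
    then show ?thesis using \<pi> by (simp add: r' bij_is_inj)
  next
    case False
    then have "inv \<pi> i \<noteq> 3" using \<pi> by (metis bij_inv_eq_iff)
    then have "inv \<pi> i = 1 \<or> inv \<pi> i = 2" using exhaust_3 by blast
    then show ?thesis using False t12 by (auto simp: r')
  qed
  have rep: "r $ 1 = r $ 2 \<or> (r $ 3 \<noteq> r $ 1 \<and> r $ 3 \<noteq> r $ 2)" using W r(1) by (auto simp: is_V_tilde_def)
  have "r $ i = ?t $ i" for i
  proof (cases "?t $ 3 = ?t $ 1")
    case True
    then show ?thesis using exhaust_3[of i] t12 rs[of i] by auto
  next
    case False
    have "\<pi> 3 = 3"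
      using exhaust_3[of "\<pi> 3"] rep False by (auto simp: rs)
    then show ?thesis using exhaust_3[of i] t12 rs[of i] by auto
  qed
  then have "r = ?t" by (simp add: vec_eq_iff)
  then show ?thesis using r(1) adm by (simp add: V_of_def)
qed

section \<open>Existence of invariant forms\<close>

theorem proposition8p1:
  fixes scale :: "'f::{alg_closed_field, field_char_0} \<Rightarrow> 'a::ab_group_add \<Rightarrow> 'a"
    and mult :: "'a \<Rightarrow> 'a \<Rightarrow> 'a"
    and \<U> :: "('f \<times> 'f) set"
    and W :: "(('f \<times> 'f) ^ 3) set"
    and \<V> :: "('f \<times> 'f \<times> 'f \<times> 'f) set"
  assumes algebra: "algebra_over scale mult"
    and two_dimensional: "vector_space.dim scale (UNIV :: 'a set) = 2"
    and nontrivial_aut: "algebra_aut scale mult \<noteq> {id}"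
    and U: "is_U \<U>"
    and V_tilde: "is_V_tilde W"
    and V: "\<V> = V_of W"
  shows
    "((\<exists>\<phi>. bilinear_form scale \<phi> \<and> symmetric_form \<phi> \<and> invariant_form scale mult \<phi>
          \<and> nondegenerate_form \<phi>) \<longleftrightarrow>
        algebra_isomorphic scale mult (*s) alg_A4_0
      \<or> (\<exists>\<alpha>. algebra_isomorphic scale mult (*s) (alg_C_0 \<alpha>))
      \<or> (\<exists>\<alpha>. (\<alpha>, 2 * \<alpha> - 1) \<in> \<U> \<and> algebra_isomorphic scale mult (*s) (alg_D1 \<alpha> (2 * \<alpha> - 1)))
      \<or> (\<exists>\<alpha> \<beta>. (\<alpha>, \<beta>, \<beta>, \<alpha>) \<in> \<V> \<and> (\<alpha>, \<beta>) \<noteq> (-1, -1) \<and>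
            algebra_isomorphic scale mult (*s) (alg_E1 \<alpha> \<beta> \<beta> \<alpha>))
      \<or> algebra_isomorphic scale mult (*s) (alg_E1 (-1) (-1) (-1) (-1))
      \<or> (\<exists>\<alpha>. algebra_isomorphic scale mult (*s) (alg_E3_diag \<alpha>)))
   \<and>
     ((\<exists>\<phi>. bilinear_form scale \<phi> \<and> skew_symmetric_form \<phi> \<and> invariant_form scale mult \<phi>
          \<and> nondegenerate_form \<phi>) \<longleftrightarrow>
        (\<exists>\<alpha>. algebra_isomorphic scale mult (*s) (alg_A1 \<alpha>))
      \<or> algebra_isomorphic scale mult (*s) alg_A2)"
    (is "(?sym \<longleftrightarrow> ?list) \<and> (?skew \<longleftrightarrow> ?list')")
proof
  interpret algebra_over scale mult by (fact algebra)
  interpret planar_algebra scale mult by unfold_locales (fact two_dimensional)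
  let ?graded = "\<exists>u v a b c d. graded_frame u v a b c d \<and> a \<noteq> 0 \<and> \<not> (b = 0 \<and> c = 0 \<and> d = 0)"
  have "?list" if gr: "?graded"
  proof -
    have "(\<alpha>, \<beta>, \<beta>, \<alpha>) \<in> \<V>" if "\<alpha> + \<beta> \<noteq> 1" "\<alpha> + \<beta> \<noteq> - 1" for \<alpha> \<beta>
      using symmetric_in_V[OF V_tilde that] V by simp
    moreover have "(\<alpha>, 2 * \<alpha> - 1) \<in> \<U>" for \<alpha> by (rule diagonal_in_U[OF U])
    ultimately show ?thesis using gr graded_imp_listed by (metis prod.inject)
  qed
  moreover have "?graded" if "?list"
  proof -
    have E1: "?graded" if "algebra_isomorphic scale mult (*s) (alg_E1 \<alpha> \<beta> \<beta> \<alpha>)" "\<alpha> + \<beta> \<noteq> 1" for \<alpha> \<beta>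
    proof -
      obtain u v where "graded_frame u v (1 - \<alpha> - \<beta>) (1 + \<alpha> - \<beta>) (1 - \<alpha> + \<beta>) (1 + \<alpha> + \<beta>)"
        using \<open>algebra_isomorphic scale mult (*s) (alg_E1 \<alpha> \<beta> \<beta> \<alpha>)\<close> E1_iff_graded by blast
      moreover have "1 - \<alpha> - \<beta> \<noteq> 0" using \<open>\<alpha> + \<beta> \<noteq> 1\<close> by (simp add: diff_diff_eq)
      moreover have "\<not> (1 + \<alpha> - \<beta> = 0 \<and> 1 - \<alpha> + \<beta> = 0)"
      proof
        assume "1 + \<alpha> - \<beta> = 0 \<and> 1 - \<alpha> + \<beta> = 0"
        then have "(1 + \<alpha> - \<beta>) + (1 - \<alpha> + \<beta>) = 0" by simp
        then show False by simp
      qed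
      ultimately show ?thesis by blast
    qed
    from that show ?thesis
    proof (elim disjE exE conjE)
      assume "algebra_isomorphic scale mult (*s) alg_A4_0"
      then show ?thesis unfolding A4_0_iff_graded by (metis zero_neq_one)
    next
      fix \<alpha> assume "algebra_isomorphic scale mult (*s) (alg_C_0 \<alpha>)"
      then show ?thesis unfolding C_0_iff_graded by (metis zero_neq_one)
    next
      fix \<alpha> assume "algebra_isomorphic scale mult (*s) (alg_D1 \<alpha> (2 * \<alpha> - 1))"
      then show ?thesis unfolding D1_iff_graded by (metis zero_neq_one neg_equal_0_iff_equal)
    next
      fix \<alpha> \<beta> assume "(\<alpha>, \<beta>, \<beta>, \<alpha>) \<in> \<V>" "algebra_isomorphic scale mult (*s) (alg_E1 \<alpha> \<beta> \<beta> \<alpha>)"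
      then show ?thesis using E1 symmetric_admissible_iff[of \<alpha> \<beta>] V by (simp add: V_of_def)
    next
      assume iso: "algebra_isomorphic scale mult (*s) (alg_E1 (-1) (-1) (-1) (-1))"
      have "(- 1) + (- 1) \<noteq> (1 :: 'f)"
      proof
        assume "(- 1) + (- 1) = (1 :: 'f)"
        then have "(3 :: 'f) = 0" by (simp add: eq_neg_iff_add_eq_0)
        then show False by simp
      qed
      then show ?thesis by (rule E1[OF iso])
    next
      fix \<alpha> assume "algebra_isomorphic scale mult (*s) (alg_E3_diag \<alpha>)"
      moreover have "\<alpha> - 1 + (- \<alpha>) \<noteq> 1"
        using eq_neg_self_imp_zero[of "1 :: 'f"] by auto
      ultimately show ?thesis using E1 unfolding E3_diag_eq_E1 by blast
    qed
  qed
  ultimately show "?sym \<longleftrightarrow> ?list"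
    unfolding symmetric_form_iff_graded[OF nontrivial_aut] by (intro iffI)
  show "?skew \<longleftrightarrow> ?list'"
    using skew_form_imp_A1_A2[OF nontrivial_aut] A1_A2_imp_skew_form by metis
qed

end
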